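(* Let $S$ be any one of the subspecies $33_3$, $33_4$, $34$, $35_3$, $35_4$, $36_1$, $36_2$, $36_s$, $37$, $38$, $39$ of isonemal fabrics. Then there exist orders $n$ such that every isonemal fabric of subspecies $S$ and of order $n$ whose symmetry group is based on a level-1 lattice unit of area $5$ (i.e. $M_1^2+N_1^2=5$) can be perfectly coloured by thin striping with $5$ colours in such a way that the set of redundant cells is arranged as the $(5,3)$ satin of order $5$.
   Context: Fabrics. Strands are parallel bands of unit width: warps are vertical, wefts horizontal, and the warp $\{i\}\times\mathbb{R}$-band and weft $\mathbb{R}\times\{j\}$-band cross in the unit square cell $(i,j)$, $i,j\in\mathbb{Z}$. A (pre)fabric specifies at every cell which of the two crossing strands lies on top as seen from a fixed side (the obverse); its design colours cell $(i,j)$ dark if the warp is on top and pale if the weft is on top. Designs are doubly periodic; a fabric is a prefabric that does not fall apart into separate layers. The order of a fabric is the common period of the dark/pale sequence along its strands. Symmetries. A symmetry is a pair $(g,\epsilon)$ where $g$ is an isometry of the plane mapping the set of strands onto itself and $\epsilon$ is either the identity or $\tau$, the reflection in the plane of the fabric (which reverses which strand is on top in every cell), such that the composite maps the fabric onto itself (strands to strands, preserving all over/under relations if $\epsilon$ is the identity, reversing all of them if $\epsilon=\tau$). They form the symmetry group $G_1$; those with $\epsilon$ the identity are side-preserving, the others side-reversing. $G_2$ denotes the group of isometric parts $g$. A fabric is isonemal if $G_1$ acts transitively on its strands. Species 33–39. These are the isonemal fabrics whose symmetry group contains quarter turns (possibly composed with $\tau$) but no reflections or glide-reflections (group type $p4$).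 A lattice unit of $G_1$ is a square whose corners are quarter-turn centres and whose sides are the vectors $(M,N)$, $(-N,M)$ generating the translation lattice of $G_1$; its centre is also a quarter-turn centre. A lattice unit is of level 1 if $M,N$ are relatively prime and of opposite parity. If the level-1 unit has side vectors $v=(M_1,N_1)$, $w=(-N_1,M_1)$, the level-2 unit (with the same centre) has side vectors $v+w$, $v-w$; the level-3 unit is the level-1 unit doubled in size, and the level-4 unit is the level-2 unit doubled; the fabric's group is said to be based on the level-1 unit of area $M_1^2+N_1^2$. A quarter-turn centre is marked $\square$ if the quarter turn about it is a side-preserving symmetry and $\blacksquare$ if it becomes a symmetry only when composed with $\tau$. The subspecies are defined by the level of the $G_1$ lattice unit and the type of quarter-turn centres at its corners and centre: $39$: level 1, one of corners/centre $\square$ and the other $\blacksquare$; $36_1$: level 1, all $\blacksquare$; $36_2$: level 2, all $\blacksquare$, quarter-turn centres at cell corners; $36_s$: level 2, all $\blacksquare$, quarter-turn centres at cell centres; $34$: level 2, all $\square$; $38$: level 3, mixed $\square$ and $\blacksquare$; $33_3$: level 3, all $\square$; $35_3$: level 3, all $\blacksquare$; $33_4$: level 4, all $\square$; $35_4$: level 4, all $\blacksquare$; $37$: level 4, mixed $\square$ and $\blacksquare$. Colouring. A colouring assigns a colour to each strand; it is perfect if every symmetry of the fabric permutes colours coherently (whenever it maps one strand of colour $a$ to a strand of colour $b$, it maps every strand of colour $a$ to a strand of colour $b$). Thin striping with $p$ colours colours consecutive parallel strands periodically $c_1,c_2,\dots,c_p,c_1,\dots$ in each direction, using the same $p$ colours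 for warps and wefts (the orders of the colours in the two directions may differ). A cell is redundant if its warp and weft have the same colour. The $(5,3)$ satin is the order-5 design whose dark cells are the cells $(i,j)$ with $j\equiv 2i \pmod 5$ (equivalently each row is the previous row displaced by 2 or 3 cells); "redundant cells arranged as the $(5,3)$ satin" means the set of redundant cells is congruent to this set of dark cells. *)

theory Defs
  imports Complex_Main
begin

text \<open>The plane is modelled as the complex plane.  Warp i is the vertical band of unit
width with centre line Re z = i, weft j the horizontal band with centre line Im z = j;
they cross in cell (i,j), whose centre is the point i + j*ii.  A design is a function
D :: int => int => bool, with D i j = True (dark) iff the warp is on top in cell (i,j)
as seen from the obverse.\<close>

datatype strand = Warp int | Weft int

definition strand_set :: "strand \<Rightarrow> complex set" where
  "strand_set s = (case s of
      Warp i \<Rightarrow> {z. \<bar>Re z - of_int i\<bar> \<le> 1/2}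
    | Weft j \<Rightarrow> {z. \<bar>Im z - of_int j\<bar> \<le> 1/2})"

definition cell :: "int \<Rightarrow> int \<Rightarrow> complex set" where
  "cell i j = strand_set (Warp i) \<inter> strand_set (Weft j)"

definition top :: "(int \<Rightarrow> int \<Rightarrow> bool) \<Rightarrow> int \<Rightarrow> int \<Rightarrow> strand" where
  "top D i j = (if D i j then Warp i else Weft j)"

definition bottom :: "(int \<Rightarrow> int \<Rightarrow> bool) \<Rightarrow> int \<Rightarrow> int \<Rightarrow> strand" where
  "bottom D i j = (if D i j then Weft j else Warp i)"

definition prefabric :: "(int \<Rightarrow> int \<Rightarrow> bool) \<Rightarrow> bool" where
  "prefabric D \<longleftrightarrow> (\<exists>a b c d :: int. a * d - b * c \<noteq> 0 \<and>
      (\<forall>i j. D (i + a) (j + b) = D i j \<and> D (i + c) (j + d) = D i j))"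

definition falls_apart :: "(int \<Rightarrow> int \<Rightarrow> bool) \<Rightarrow> bool" where
  "falls_apart D \<longleftrightarrow> (\<exists>L :: strand set. L \<noteq> {} \<and> L \<noteq> UNIV \<and>
      (\<forall>i j. (Warp i \<in> L \<and> Weft j \<notin> L \<longrightarrow> D i j) \<and>
             (Weft j \<in> L \<and> Warp i \<notin> L \<longrightarrow> \<not> D i j)))"

definition fabric :: "(int \<Rightarrow> int \<Rightarrow> bool) \<Rightarrow> bool" where
  "fabric D \<longleftrightarrow> prefabric D \<and> \<not> falls_apart D"

definition order :: "(int \<Rightarrow> int \<Rightarrow> bool) \<Rightarrow> nat" where
  "order D = (LEAST n::nat. n > 0 \<and>
      (\<forall>i j. D i (j + int n) = D i j \<and> D (i + int n) j = D i j))"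

definition plane_isometry :: "(complex \<Rightarrow> complex) \<Rightarrow> bool" where
  "plane_isometry g \<longleftrightarrow> (\<forall>z w. dist (g z) (g w) = dist z w)"

definition strand_preserving :: "(complex \<Rightarrow> complex) \<Rightarrow> bool" where
  "strand_preserving g \<longleftrightarrow> (\<lambda>S. g ` S) ` range strand_set = range strand_set"

text \<open>A symmetry is a pair (g, e): g an isometry of the plane mapping the set of strands
onto itself, e = False the identity and e = True the reflection tau in the plane of the
fabric; over/under relations are preserved (e = False) or all reversed (e = True).\<close>
definition is_sym :: "(int \<Rightarrow> int \<Rightarrow> bool) \<Rightarrow> (complex \<Rightarrow> complex) \<Rightarrow> bool \<Rightarrow> bool" where
  "is_sym D g e \<longleftrightarrow> plane_isometry g \<and> strand_preserving g \<and>
     (\<forall>i j i' j'. g ` cell i j = cell i' j' \<longrightarrow>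
        g ` strand_set (top D i j) =
          strand_set (if e then bottom D i' j' else top D i' j'))"

definition isonemal :: "(int \<Rightarrow> int \<Rightarrow> bool) \<Rightarrow> bool" where
  "isonemal D \<longleftrightarrow> (\<forall>s t. \<exists>g e. is_sym D g e \<and> g ` strand_set s = strand_set t)"

text \<open>Reflection (s = 0) or glide-reflection in the line through a with direction angle th.\<close>
definition glide_reflection :: "(complex \<Rightarrow> complex) \<Rightarrow> bool" where
  "glide_reflection g \<longleftrightarrow> (\<exists>a th s.
      g = (\<lambda>z. a + cis (2 * th) * cnj (z - a) + of_real s * cis th))"

definition quarter_turn :: "complex \<Rightarrow> complex \<Rightarrow> complex" where
  "quarter_turn c = (\<lambda>z. c + \<i> * (z - c))"

text \<open>Quarter-turn centre of type e: e = False is a white square (side-preserving quarter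
turn), e = True a black square (quarter turn composed with tau).\<close>
definition qcentre :: "(int \<Rightarrow> int \<Rightarrow> bool) \<Rightarrow> complex \<Rightarrow> bool \<Rightarrow> bool" where
  "qcentre D c e \<longleftrightarrow> is_sym D (quarter_turn c) e"

definition p4_isonemal :: "(int \<Rightarrow> int \<Rightarrow> bool) \<Rightarrow> bool" where
  "p4_isonemal D \<longleftrightarrow> fabric D \<and> isonemal D \<and>
     (\<exists>c e. qcentre D c e) \<and> \<not> (\<exists>g e. is_sym D g e \<and> glide_reflection g)"

definition trans_lattice :: "(int \<Rightarrow> int \<Rightarrow> bool) \<Rightarrow> complex set" where
  "trans_lattice D = {t. \<exists>e. is_sym D (\<lambda>z. z + t) e}"

definition lattice_gen :: "complex \<Rightarrow> complex set" where
  "lattice_gen v = {of_int a * v + of_int b * (\<i> * v) | a b. True}"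

definition level1_vec :: "complex \<Rightarrow> bool" where
  "level1_vec v \<longleftrightarrow> (\<exists>M N :: int. v = Complex (of_int M) (of_int N) \<and>
      coprime M N \<and> odd (M + N))"

definition level_vec :: "nat \<Rightarrow> complex \<Rightarrow> complex" where
  "level_vec k v1 = (if k = 1 then v1 else if k = 2 then (1 + \<i>) * v1
      else if k = 3 then 2 * v1 else 2 * (1 + \<i>) * v1)"

definition unit_centre :: "complex \<Rightarrow> complex \<Rightarrow> complex" where
  "unit_centre c v = c + (v + \<i> * v) / 2"

definition lattice_unit ::
  "(int \<Rightarrow> int \<Rightarrow> bool) \<Rightarrow> nat \<Rightarrow> complex \<Rightarrow> complex \<Rightarrow> bool \<Rightarrow> bool \<Rightarrow> bool" where
  "lattice_unit D k v1 c ec ez \<longleftrightarrow> k \<in> {1,2,3,4} \<and> level1_vec v1 \<and>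
     trans_lattice D = lattice_gen (level_vec k v1) \<and>
     qcentre D c ec \<and> qcentre D (unit_centre c (level_vec k v1)) ez"

definition at_cell_centre :: "complex \<Rightarrow> bool" where
  "at_cell_centre c \<longleftrightarrow> Re c \<in> \<int> \<and> Im c \<in> \<int>"

definition at_cell_corner :: "complex \<Rightarrow> bool" where
  "at_cell_corner c \<longleftrightarrow> Re c - 1/2 \<in> \<int> \<and> Im c - 1/2 \<in> \<int>"

datatype subspecies =
  S33_3 | S33_4 | S34 | S35_3 | S35_4 | S36_1 | S36_2 | S36_s | S37 | S38 | S39

text \<open>Subspecies condition on (level, corner, corner type, centre type);
False = white square, True = black square.\<close>
fun subsp_cond :: "subspecies \<Rightarrow> nat \<Rightarrow> complex \<Rightarrow> bool \<Rightarrow> bool \<Rightarrow> bool" where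
  "subsp_cond S39 k c ec ez = (k = 1 \<and> ec \<noteq> ez)"
| "subsp_cond S36_1 k c ec ez = (k = 1 \<and> ec \<and> ez)"
| "subsp_cond S36_2 k c ec ez = (k = 2 \<and> ec \<and> ez \<and> at_cell_corner c)"
| "subsp_cond S36_s k c ec ez = (k = 2 \<and> ec \<and> ez \<and> at_cell_centre c)"
| "subsp_cond S34 k c ec ez = (k = 2 \<and> \<not> ec \<and> \<not> ez)"
| "subsp_cond S38 k c ec ez = (k = 3 \<and> ec \<noteq> ez)"
| "subsp_cond S33_3 k c ec ez = (k = 3 \<and> \<not> ec \<and> \<not> ez)"
| "subsp_cond S35_3 k c ec ez = (k = 3 \<and> ec \<and> ez)"
| "subsp_cond S33_4 k c ec ez = (k = 4 \<and> \<not> ec \<and> \<not> ez)"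
| "subsp_cond S35_4 k c ec ez = (k = 4 \<and> ec \<and> ez)"
| "subsp_cond S37 k c ec ez = (k = 4 \<and> ec \<noteq> ez)"

definition in_subspecies :: "subspecies \<Rightarrow> (int \<Rightarrow> int \<Rightarrow> bool) \<Rightarrow> bool" where
  "in_subspecies S D \<longleftrightarrow> p4_isonemal D \<and>
     (\<exists>k v1 c ec ez. lattice_unit D k v1 c ec ez \<and> subsp_cond S k c ec ez)"

definition based_on_area :: "(int \<Rightarrow> int \<Rightarrow> bool) \<Rightarrow> real \<Rightarrow> bool" where
  "based_on_area D A \<longleftrightarrow> (\<exists>k v1 c ec ez. lattice_unit D k v1 c ec ez \<and> (cmod v1)\<^sup>2 = A)"

definition perfect_colouring :: "(int \<Rightarrow> int \<Rightarrow> bool) \<Rightarrow> (strand \<Rightarrow> 'c) \<Rightarrow> bool" where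
  "perfect_colouring D col \<longleftrightarrow> (\<forall>g e. is_sym D g e \<longrightarrow>
     (\<forall>s s' t t'. g ` strand_set s = strand_set t \<and> g ` strand_set s' = strand_set t' \<and>
        col s = col s' \<longrightarrow> col t = col t'))"

definition thin_striping :: "nat \<Rightarrow> (strand \<Rightarrow> 'c) \<Rightarrow> bool" where
  "thin_striping p col \<longleftrightarrow> (\<exists>a b :: int \<Rightarrow> 'c.
     inj_on a {0..<int p} \<and> inj_on b {0..<int p} \<and> a ` {0..<int p} = b ` {0..<int p} \<and>
     (\<forall>i. col (Warp i) = a (i mod int p)) \<and> (\<forall>j. col (Weft j) = b (j mod int p)))"

definition redundant_cells :: "(strand \<Rightarrow> 'c) \<Rightarrow> (int \<times> int) set" where
  "redundant_cells col = {(i, j). col (Warp i) = col (Weft j)}"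

definition cell_centre :: "int \<times> int \<Rightarrow> complex" where
  "cell_centre p = Complex (of_int (fst p)) (of_int (snd p))"

definition satin_5_3 :: "(int \<times> int) set" where
  "satin_5_3 = {(i, j). j mod 5 = (2 * i) mod 5}"

definition congruent_cells :: "(int \<times> int) set \<Rightarrow> (int \<times> int) set \<Rightarrow> bool" where
  "congruent_cells A B \<longleftrightarrow> (\<exists>g. plane_isometry g \<and> g ` (cell_centre ` A) = cell_centre ` B)"

end

(* Every symmetry is a signed permutation of the two coordinates followed by an integer
   translation.  When the level-1 unit has area 5, the translation lattice lies in
   {(s, t). t = r s (mod 5)} for some r with r^2 = -1 (mod 5), and without (glide-)reflections the
   symmetries are generated by translations and one quarter turn.  The striping that gives
   warp i the colour r i + c and weft j the colour j (mod 5) is therefore perfect as soon as c is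
   chosen so that the set j = r i + c of redundant cells is invariant under that quarter turn.
   This works for every order, so only one fabric per subspecies has to be exhibited; its order
   then serves as n.  Its translation lattice is a multiple of (1 + 2i), which is not invariant under
   conjugation, and this alone excludes (glide-)reflections. *)

theory Submission
  imports Defs
begin

subsection \<open>Isometries preserving the strands\<close>

text \<open>Perfection reduces to one set of cells: two parallel strands share a colour exactly when
  some strand across both meets them in redundant cells, so a symmetry that maps redundant cells to
  redundant cells respects all colour classes. Inserting j = r i + c into the quarter turn (i, j) to
  (a - j, i + b) leaves the single congruence (r - 1) c = r a - b (mod 5), and r - 1 is a unit for
  both roots, r = 2 and r = 3. The roots correspond to the two Gaussian prime ideals (1 + 2i) and (1
  - 2i) above 5.

  The common modulus of the examples comes from the worst case, level 4 with mixed centres: there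
  both sides of the unit are side-reversing, so the side-preserving translations form (1 + i) times
  the lattice of 2(1 + i)(1 + 2i), which is that of 4(1 + 2i), of index 80. Every claim about an
  example thus becomes a finite check on 80 residue pairs, including the absence of further
  translations, which fixes the level.\<close>

definition gmap :: "bool \<Rightarrow> int \<Rightarrow> int \<Rightarrow> int \<Rightarrow> int \<Rightarrow> complex \<Rightarrow> complex" where
  "gmap sw p q a b z =
     (if sw then Complex (of_int p * Im z + of_int a) (of_int q * Re z + of_int b)
      else Complex (of_int p * Re z + of_int a) (of_int q * Im z + of_int b))"

definition sign :: "int \<Rightarrow> bool" where "sign p \<longleftrightarrow> p = 1 \<or> p = -1"

fun act_strand :: "bool \<Rightarrow> int \<Rightarrow> int \<Rightarrow> int \<Rightarrow> int \<Rightarrow> strand \<Rightarrow> strand" where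
  "act_strand sw p q a b (Warp i) = (if sw then Weft (q * i + b) else Warp (p * i + a))"
| "act_strand sw p q a b (Weft j) = (if sw then Warp (p * j + a) else Weft (q * j + b))"

definition act_x :: "bool \<Rightarrow> int \<Rightarrow> int \<Rightarrow> int \<Rightarrow> int \<Rightarrow> int" where
  "act_x sw p a i j = p * (if sw then j else i) + a"

definition act_y :: "bool \<Rightarrow> int \<Rightarrow> int \<Rightarrow> int \<Rightarrow> int \<Rightarrow> int" where
  "act_y sw q b i j = q * (if sw then i else j) + b"

text \<open>A quarter turn interchanges warps and wefts, so it acts on designs as the complement
  when it is side-preserving.\<close>
definition design_sym ::
  "(int \<Rightarrow> int \<Rightarrow> bool) \<Rightarrow> bool \<Rightarrow> int \<Rightarrow> int \<Rightarrow> int \<Rightarrow> int \<Rightarrow> bool \<Rightarrow> bool" where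
  "design_sym D sw p q a b e \<longleftrightarrow>
     (\<forall>i j. D (act_x sw p a i j) (act_y sw q b i j) = (D i j \<noteq> (sw \<noteq> e)))"

lemma bounded_affine_imp_zero:
  fixes c d k :: real
  assumes "\<And>y. \<bar>c * y + d\<bar> \<le> k"
  shows "c = 0"
proof (rule ccontr)
  assume "c \<noteq> 0"
  then have "\<bar>c * ((k + 1 - d) / c) + d\<bar> = \<bar>k + 1\<bar>" by simp
  then show False using assms[of "(k + 1 - d) / c"] by linarith
qed

text \<open>Dividing out the rotation \<open>a\<close> leaves a map that fixes 0 and 1. Distances to
  these two points determine the real part; the image of i, which is i or -i, then fixes the sign of
  the imaginary part.\<close>

lemma plane_isometry_cases:
  assumes "plane_isometry g"
  obtains a b where "cmod a = 1" "(\<forall>z. g z = a * z + b) \<or> (\<forall>z. g z = a * cnj z + b)"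
proof -
  define a where "a = g 1 - g 0"
  have d: "cmod (g z - g w) = cmod (z - w)" for z w
    using assms unfolding plane_isometry_def dist_norm by auto
  have a1: "cmod a = 1" using d[of 1 0] by (simp add: a_def)
  then have a0: "a \<noteq> 0" by auto
  define k where "k z = (g z - g 0) / a" for z
  have gk: "g z = a * k z + g 0" for z using a0 by (simp add: k_def)
  have kd: "cmod (k z - k w) = cmod (z - w)" for z w
  proof -
    have "k z - k w = (g z - g w) / a" by (simp add: k_def diff_divide_distrib)
    then show ?thesis using d a1 by (simp add: norm_divide)
  qed
  have k0: "k 0 = 0" and k1: "k 1 = 1" using a0 by (simp_all add: k_def a_def)
  have sq: "(Re (k z) - Re (k w))\<^sup>2 + (Im (k z) - Im (k w))\<^sup>2 = (Re z - Re w)\<^sup>2 + (Im z - Im w)\<^sup>2"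
    for z w using kd[of z w] by (simp add: cmod_def)
  have re: "Re (k z) = Re z" for z
    using sq[of z 0] sq[of z 1] by (simp add: k0 k1 power2_eq_square algebra_simps)
  have "(Im (k \<i>))\<^sup>2 = 1" using sq[of \<i> 0] re[of \<i>] by (simp add: k0)
  then consider "Im (k \<i>) = 1" | "Im (k \<i>) = -1" by (auto simp: power2_eq_1_iff)
  then have "(\<forall>z. k z = z) \<or> (\<forall>z. k z = cnj z)"
  proof cases
    case 1
    have "Im (k z) = Im z" for z
      using sq[of z 0] sq[of z \<i>] 1 by (simp add: k0 re power2_eq_square algebra_simps)
    then show ?thesis using re by (simp add: complex_eq_iff)
  next
    case 2
    have "Im (k z) = - Im z" for z
      using sq[of z 0] sq[of z \<i>] 2 by (simp add: k0 re power2_eq_square algebra_simps)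
    then show ?thesis using re by (simp add: complex_eq_iff)
  qed
  then show ?thesis using that[OF a1, of "g 0"] gk by metis
qed

lemma strand_set_simps:
  "z \<in> strand_set (Warp i) \<longleftrightarrow> \<bar>Re z - of_int i\<bar> \<le> 1/2"
  "z \<in> strand_set (Weft j) \<longleftrightarrow> \<bar>Im z - of_int j\<bar> \<le> 1/2"
  by (simp_all add: strand_set_def)

text \<open>A few test points suffice: the two edges of a parallel strand fix its position, and a
  perpendicular strand contains a point at distance 1 from the centre line of
  \<open>t\<close>.\<close>

lemma strand_set_subset_imp_eq:
  assumes "strand_set s \<subseteq> strand_set t"
  shows "s = t"
proof (cases s; cases t)
  fix i i' assume st: "s = Warp i" "t = Warp i'"
  have "Complex (i + 1/2) 0 \<in> strand_set t" "Complex (i - 1/2) 0 \<in> strand_set t"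
    by (rule assms[THEN subsetD], simp add: st strand_set_simps)+
  then have "real_of_int i = real_of_int i'"
    unfolding st strand_set_simps complex.sel by linarith
  then show ?thesis using st by simp
next
  fix j j' assume st: "s = Weft j" "t = Weft j'"
  have "Complex 0 (j + 1/2) \<in> strand_set t" "Complex 0 (j - 1/2) \<in> strand_set t"
    by (rule assms[THEN subsetD], simp add: st strand_set_simps)+
  then have "real_of_int j = real_of_int j'"
    unfolding st strand_set_simps complex.sel by linarith
  then show ?thesis using st by simp
next
  fix i j assume st: "s = Warp i" "t = Weft j"
  have "Complex i (j + 1) \<in> strand_set t"
    by (rule assms[THEN subsetD], simp add: st strand_set_simps)
  then show ?thesis using st by (simp add: strand_set_simps)
next
  fix i j assume st: "s = Weft j" "t = Warp i"
  have "Complex (i + 1) j \<in> strand_set t"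
    by (rule assms[THEN subsetD], simp add: st strand_set_simps)
  then show ?thesis using st by (simp add: strand_set_simps)
qed

lemma inj_strand_set: "inj strand_set"
  by (auto intro!: injI strand_set_subset_imp_eq)

lemma cell_eq_iff: "cell i j = cell i' j' \<longleftrightarrow> i = i' \<and> j = j'"
proof
  assume eq: "cell i j = cell i' j'"
  have "Complex (i + 1/2) (j + 1/2) \<in> cell i' j'" "Complex (i - 1/2) (j - 1/2) \<in> cell i' j'"
    unfolding eq[symmetric] by (simp_all add: cell_def strand_set_simps)
  then have "real_of_int i = real_of_int i'" "real_of_int j = real_of_int j'"
    unfolding cell_def Int_iff strand_set_simps complex.sel by linarith+
  then show "i = i' \<and> j = j'" by simp
qed simp

text \<open>The inverse has the same form. With a swap the two signs change places, because the sign
  of the new abscissa belongs to the old ordinate.\<close>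

lemma gmap_apply_inverse:
  assumes "sign p" "sign q"
  shows "gmap sw p q a b
    (gmap sw (if sw then q else p) (if sw then p else q)
       (if sw then - q * b else - p * a) (if sw then - p * a else - q * b) z) = z"
  using assms by (auto simp: gmap_def sign_def complex_eq_iff)

lemma inj_gmap:
  assumes "sign p" "sign q"
  shows "inj (gmap sw p q a b)"
  using assms by (auto intro!: injI simp: gmap_def sign_def complex_eq_iff split: if_splits)

lemma gmap_in_act_strand_iff:
  assumes "sign p" "sign q"
  shows "gmap sw p q a b z \<in> strand_set (act_strand sw p q a b s) \<longleftrightarrow> z \<in> strand_set s"
  using assms by (cases s) (auto simp: gmap_def sign_def strand_set_simps abs_minus_commute)

lemma gmap_image_strand:
  assumes "sign p" "sign q"
  shows "gmap sw p q a b ` strand_set s = strand_set (act_strand sw p q a b s)"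
proof
  show "gmap sw p q a b ` strand_set s \<subseteq> strand_set (act_strand sw p q a b s)"
    using gmap_in_act_strand_iff[OF assms] by blast
  show "strand_set (act_strand sw p q a b s) \<subseteq> gmap sw p q a b ` strand_set s"
  proof
    fix z assume "z \<in> strand_set (act_strand sw p q a b s)"
    then show "z \<in> gmap sw p q a b ` strand_set s"
      using gmap_apply_inverse[OF assms, of sw a b z] gmap_in_act_strand_iff[OF assms]
      by (metis imageI)
  qed
qed

lemma gmap_image_cell:
  assumes "sign p" "sign q"
  shows "gmap sw p q a b ` cell i j = cell (act_x sw p a i j) (act_y sw q b i j)"
  unfolding cell_def image_Int[OF inj_gmap[OF assms]] gmap_image_strand[OF assms]
  by (auto simp: act_x_def act_y_def)

lemma surj_act_strand:
  assumes "sign p" "sign q"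
  shows "surj (act_strand sw p q a b)"
proof (rule surjI)
  fix s show "act_strand sw p q a b
    (act_strand sw (if sw then q else p) (if sw then p else q)
       (if sw then - q * b else - p * a) (if sw then - p * a else - q * b) s) = s"
    using assms by (cases s) (auto simp: sign_def)
qed

lemma plane_isometry_gmap:
  assumes "sign p" "sign q"
  shows "plane_isometry (gmap sw p q a b)"
  using assms
  by (auto simp: plane_isometry_def gmap_def sign_def dist_norm cmod_def power2_eq_square
      algebra_simps)

lemma strand_preserving_gmap:
  assumes "sign p" "sign q"
  shows "strand_preserving (gmap sw p q a b)"
proof -
  have "(\<lambda>S. gmap sw p q a b ` S) ` range strand_set
      = strand_set ` range (act_strand sw p q a b)"
    by (simp add: image_image gmap_image_strand[OF assms])
  then show ?thesis unfolding strand_preserving_def surj_act_strand[OF assms] .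
qed

lemma centred_band_unique:
  fixes c d :: real
  assumes "sign p" and "\<And>x. \<bar>x\<bar> \<le> 1/2 \<Longrightarrow> \<bar>of_int p * x + c - d\<bar> \<le> 1/2"
  shows "c = d"
proof -
  have "\<bar>of_int p * (1/2) + c - d\<bar> \<le> 1/2" "\<bar>of_int p * (-1/2) + c - d\<bar> \<le> 1/2"
    by (rule assms(2), simp)+
  moreover have "real_of_int p = 1 \<or> real_of_int p = -1"
    using assms(1) by (auto simp: sign_def)
  ultimately show ?thesis by (elim disjE; simp only:; linarith)
qed

lemma strand_preserving_isometry_cases:
  assumes g: "plane_isometry g" and sp: "strand_preserving g"
  obtains sw p q a b where "sign p" "sign q" "g = gmap sw p q a b"
proof -
  have ex: "\<exists>t. g ` strand_set s = strand_set t" for s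
  proof -
    have "g ` strand_set s \<in> (\<lambda>S. g ` S) ` range strand_set" by (intro imageI rangeI)
    then have "g ` strand_set s \<in> range strand_set"
      using sp unfolding strand_preserving_def by simp
    then show ?thesis by auto
  qed
  obtain s where s: "g ` strand_set (Warp 0) = strand_set s" using ex by blast
  obtain t where t: "g ` strand_set (Weft 0) = strand_set t" using ex by blast
  have ms: "g z \<in> strand_set s" if "\<bar>Re z\<bar> \<le> 1/2" for z
    unfolding s[symmetric] using that by (simp add: strand_set_simps)
  have mt: "g z \<in> strand_set t" if "\<bar>Im z\<bar> \<le> 1/2" for z
    unfolding t[symmetric] using that by (simp add: strand_set_simps)
  obtain a b where a1: "cmod a = 1"
    and gab: "(\<forall>z. g z = a * z + b) \<or> (\<forall>z. g z = a * cnj z + b)"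
    using plane_isometry_cases[OF g] .
  \<comment> \<open>\<open>k\<close> is 1 for a direct and -1 for an opposite isometry, so that one
    formula serves both.\<close>
  obtain k where k: "sign k" and gk: "\<And>z. g z = a * Complex (Re z) (of_int k * Im z) + b"
  proof -
    from gab show ?thesis
    proof
      assume "\<forall>z. g z = a * z + b"
      then show ?thesis using that[of 1] by (simp add: sign_def)
    next
      assume "\<forall>z. g z = a * cnj z + b"
      moreover have "cnj z = Complex (Re z) (of_int (-1) * Im z)" for z
        by (simp add: complex_eq_iff)
      ultimately show ?thesis using that[of "-1"] by (simp add: sign_def)
    qed
  qed
  \<comment> \<open>The imaginary axis lies in \<open>Warp 0\<close>, so its image stays within the
    bounded width of \<open>s\<close>; this forces the image to be parallel to a coordinate
    axis.\<close>
  have "Re a = 0 \<or> Im a = 0"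
  proof (cases s)
    case (Warp n)
    have "\<bar>(- Im a * of_int k) * y + (Re b - n)\<bar> \<le> 1/2" for y
      using ms[of "Complex 0 y"] unfolding Warp strand_set_simps gk by (simp add: algebra_simps)
    from bounded_affine_imp_zero[OF this] show ?thesis using k by (auto simp: sign_def)
  next
    case (Weft n)
    have "\<bar>(Re a * of_int k) * y + (Im b - n)\<bar> \<le> 1/2" for y
      using ms[of "Complex 0 y"] unfolding Weft strand_set_simps gk by (simp add: algebra_simps)
    from bounded_affine_imp_zero[OF this] show ?thesis using k by (auto simp: sign_def)
  qed
  then obtain sw p q where pq: "sign p" "sign q"
    and gc: "\<And>z. g z = (if sw then Complex (of_int p * Im z + Re b) (of_int q * Re z + Im b)
      else Complex (of_int p * Re z + Re b) (of_int q * Im z + Im b))"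
  proof
    assume 0: "Re a = 0"
    then have "Im a = of_int 1 \<or> Im a = of_int (-1)"
      using a1 by (auto simp: cmod_def)
    then obtain m where m: "Im a = of_int m" "sign m"
      unfolding sign_def by blast
    show ?thesis
    proof (rule that[of "- (m * k)" m True])
      show "sign (- (m * k))" "sign m" using k m by (auto simp: sign_def)
      show "g z = (if True then Complex (of_int (- (m * k)) * Im z + Re b) (of_int m * Re z + Im b)
        else Complex (of_int (- (m * k)) * Re z + Re b) (of_int m * Im z + Im b))" for z
        unfolding gk by (simp add: complex_eq_iff 0 m)
    qed
  next
    assume 0: "Im a = 0"
    then have "Re a = of_int 1 \<or> Re a = of_int (-1)"
      using a1 by (auto simp: cmod_def)
    then obtain m where m: "Re a = of_int m" "sign m"
      unfolding sign_def by blast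
    show ?thesis
    proof (rule that[of m "m * k" False])
      show "sign m" "sign (m * k)" using k m by (auto simp: sign_def)
      show "g z = (if False then Complex (of_int m * Im z + Re b) (of_int (m * k) * Re z + Im b)
        else Complex (of_int m * Re z + Re b) (of_int (m * k) * Im z + Im b))" for z
        unfolding gk by (simp add: complex_eq_iff 0 m)
    qed
  qed
  \<comment> \<open>\<open>b\<close> is the image of 0. Each of the two strands centred at 0 goes to
    a strand whose centre line has an integral position, and this gives one coordinate of
    \<open>b\<close>.\<close>
  have "Re b \<in> \<int> \<and> Im b \<in> \<int>"
  proof (cases sw)
    case False
    obtain n where n: "s = Warp n"
    proof (cases s)
      case (Weft n)
      have "\<bar>of_int q * y + (Im b - n)\<bar> \<le> 1/2" for y
        using ms[of "Complex 0 y"] False unfolding Weft strand_set_simps gc by (simp add: algebra_simps)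
      then have "real_of_int q = 0" by (rule bounded_affine_imp_zero)
      then show ?thesis using pq by (simp add: sign_def)
    qed (rule that)
    obtain m where m: "t = Weft m"
    proof (cases t)
      case (Warp n)
      have "\<bar>of_int p * y + (Re b - n)\<bar> \<le> 1/2" for y
        using mt[of "Complex y 0"] False unfolding Warp strand_set_simps gc by (simp add: algebra_simps)
      then have "real_of_int p = 0" by (rule bounded_affine_imp_zero)
      then show ?thesis using pq by (simp add: sign_def)
    qed (rule that)
    have "Re b = n"
    proof (rule centred_band_unique[OF pq(1)])
      fix x :: real assume "\<bar>x\<bar> \<le> 1/2"
      then show "\<bar>of_int p * x + Re b - n\<bar> \<le> 1/2"
        using ms[of "Complex x 0"] False unfolding n strand_set_simps gc by simp
    qed
    moreover have "Im b = m"
    proof (rule centred_band_unique[OF pq(2)])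
      fix x :: real assume "\<bar>x\<bar> \<le> 1/2"
      then show "\<bar>of_int q * x + Im b - m\<bar> \<le> 1/2"
        using mt[of "Complex 0 x"] False unfolding m strand_set_simps gc by simp
    qed
    ultimately show ?thesis by simp
  next
    case True
    obtain n where n: "s = Weft n"
    proof (cases s)
      case (Warp n)
      have "\<bar>of_int p * y + (Re b - n)\<bar> \<le> 1/2" for y
        using ms[of "Complex 0 y"] True unfolding Warp strand_set_simps gc by (simp add: algebra_simps)
      then have "real_of_int p = 0" by (rule bounded_affine_imp_zero)
      then show ?thesis using pq by (simp add: sign_def)
    qed (rule that)
    obtain m where m: "t = Warp m"
    proof (cases t)
      case (Weft n)
      have "\<bar>of_int q * y + (Im b - n)\<bar> \<le> 1/2" for y
        using mt[of "Complex y 0"] True unfolding Weft strand_set_simps gc by (simp add: algebra_simps)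
      then have "real_of_int q = 0" by (rule bounded_affine_imp_zero)
      then show ?thesis using pq by (simp add: sign_def)
    qed (rule that)
    have "Im b = n"
    proof (rule centred_band_unique[OF pq(2)])
      fix x :: real assume "\<bar>x\<bar> \<le> 1/2"
      then show "\<bar>of_int q * x + Im b - n\<bar> \<le> 1/2"
        using ms[of "Complex x 0"] True unfolding n strand_set_simps gc by simp
    qed
    moreover have "Re b = m"
    proof (rule centred_band_unique[OF pq(1)])
      fix x :: real assume "\<bar>x\<bar> \<le> 1/2"
      then show "\<bar>of_int p * x + Re b - m\<bar> \<le> 1/2"
        using mt[of "Complex 0 x"] True unfolding m strand_set_simps gc by simp
    qed
    ultimately show ?thesis by simp
  qed
  then obtain x y where "Re b = of_int x" "Im b = of_int y" by (auto elim!: Ints_cases)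
  then have "g = gmap sw p q x y" using gc by (auto simp: gmap_def)
  then show ?thesis using that pq by blast
qed

lemma is_sym_gmap_iff:
  assumes "sign p" "sign q"
  shows "is_sym D (gmap sw p q a b) e \<longleftrightarrow> design_sym D sw p q a b e"
  unfolding is_sym_def design_sym_def gmap_image_cell[OF assms] gmap_image_strand[OF assms]
    cell_eq_iff inj_eq[OF inj_strand_set]
  using plane_isometry_gmap[OF assms] strand_preserving_gmap[OF assms]
  by (auto simp: top_def bottom_def act_x_def act_y_def)

lemma is_symE:
  assumes "is_sym D g e"
  obtains sw p q a b where "sign p" "sign q" "g = gmap sw p q a b" "design_sym D sw p q a b e"
proof -
  from assms have "plane_isometry g" "strand_preserving g" by (simp_all add: is_sym_def)
  then obtain sw p q a b where *: "sign p" "sign q" "g = gmap sw p q a b"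
    by (rule strand_preserving_isometry_cases)
  with assms have "design_sym D sw p q a b e" by (simp add: is_sym_gmap_iff)
  with * show ?thesis by (rule that)
qed

subsection \<open>Colouring by the satin\<close>

lemma design_sym_compose:
  assumes "design_sym D sw p q a b e" "design_sym D sw' p' q' a' b' e'"
  shows "design_sym D (sw \<noteq> sw') (p' * (if sw' then q else p)) (q' * (if sw' then p else q))
    (p' * (if sw' then b else a) + a') (q' * (if sw' then a else b) + b') (e \<noteq> e')"
  unfolding design_sym_def
proof (intro allI)
  fix i j
  let ?x = "act_x sw p a i j" and ?y = "act_y sw q b i j"
  have "act_x (sw \<noteq> sw') (p' * (if sw' then q else p)) (p' * (if sw' then b else a) + a') i j
      = act_x sw' p' a' ?x ?y"
    "act_y (sw \<noteq> sw') (q' * (if sw' then p else q)) (q' * (if sw' then a else b) + b') i j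
      = act_y sw' q' b' ?x ?y"
    by (auto simp: act_x_def act_y_def algebra_simps)
  then show "D (act_x (sw \<noteq> sw') (p' * (if sw' then q else p)) (p' * (if sw' then b else a) + a') i j)
       (act_y (sw \<noteq> sw') (q' * (if sw' then p else q)) (q' * (if sw' then a else b) + b') i j)
      = (D i j \<noteq> ((sw \<noteq> sw') \<noteq> (e \<noteq> e')))"
    using assms unfolding design_sym_def by auto
qed

lemma gmap_translation: "gmap False 1 1 a b = (\<lambda>z. z + Complex (of_int a) (of_int b))"
  by (auto simp: gmap_def complex_eq_iff)

text \<open>The centre solves c (1 - i) = a + b i. As a - b and a + b have the same parity, it is a
  cell centre or a cell corner.\<close>

lemma gmap_quarter_turn:
  "gmap True (-1) 1 a b = quarter_turn (Complex ((of_int a - of_int b) / 2) ((of_int a + of_int b) / 2))"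
  by (auto simp: gmap_def quarter_turn_def complex_eq_iff field_simps)

lemma trans_lattice_iff:
  "t \<in> trans_lattice D \<longleftrightarrow>
     (\<exists>a b e. t = Complex (of_int a) (of_int b) \<and> design_sym D False 1 1 a b e)"
proof
  assume "t \<in> trans_lattice D"
  then obtain e where "is_sym D (\<lambda>z. z + t) e" by (auto simp: trans_lattice_def)
  then obtain sw p q a b where *: "sign p" "sign q" "(\<lambda>z. z + t) = gmap sw p q a b"
    "design_sym D sw p q a b e" by (rule is_symE)
  have "t = gmap sw p q a b 0" "1 + t = gmap sw p q a b 1" "\<i> + t = gmap sw p q a b \<i>"
    unfolding *(3)[symmetric] by simp_all
  then have "\<not> sw" "p = 1" "q = 1" "t = Complex (of_int a) (of_int b)"
    by (auto simp: gmap_def complex_eq_iff split: if_splits)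
  then show "\<exists>a b e. t = Complex (of_int a) (of_int b) \<and> design_sym D False 1 1 a b e"
    using *(4) by auto
next
  assume "\<exists>a b e. t = Complex (of_int a) (of_int b) \<and> design_sym D False 1 1 a b e"
  then show "t \<in> trans_lattice D"
    using is_sym_gmap_iff[of 1 1 D False, unfolded gmap_translation]
    by (auto simp: trans_lattice_def sign_def)
qed

lemma qcentreE:
  assumes "qcentre D c e"
  obtains a b where "design_sym D True (-1) 1 a b e"
proof -
  have "is_sym D (quarter_turn c) e" using assms by (simp add: qcentre_def)
  then obtain sw p q a b where *: "sign p" "sign q" "quarter_turn c = gmap sw p q a b"
    "design_sym D sw p q a b e" by (rule is_symE)
  have "\<i> + gmap sw p q a b 0 = gmap sw p q a b 1" "gmap sw p q a b 0 - 1 = gmap sw p q a b \<i>"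
    unfolding *(3)[symmetric] by (simp_all add: quarter_turn_def algebra_simps)
  then have "sw" "p = -1" "q = 1"
    by (auto simp: gmap_def complex_eq_iff split: if_splits)
  then show ?thesis using *(4) that by simp
qed

text \<open>The axis has the direction of a square root \<open>u\<close> of \<alpha>. The component
  of \<beta> along \<open>u\<close> is the glide; the component across \<open>u\<close> is absorbed
  by moving the axis by half of it.\<close>

lemma glide_reflectionI:
  assumes "cmod \<alpha> = 1" and "\<And>z. g z = \<alpha> * cnj z + \<beta>"
  shows "glide_reflection g"
proof -
  define u where "u = cis (Arg \<alpha> / 2)"
  have uu: "u * cnj u = 1" by (simp add: u_def flip: complex_norm_square)
  have \<alpha>: "\<alpha> = u * u"
    using rcis_cmod_Arg[of \<alpha>] by (simp add: u_def cis_mult assms(1) rcis_def)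
  have cis2: "cis (2 * (Arg \<alpha> / 2)) = u * u" by (simp add: u_def cis_mult)
  define s where "s = \<beta> * cnj u"
  have \<beta>: "\<beta> = of_real (Re s) * u + \<i> * of_real (Im s) * u"
  proof -
    have "\<beta> = s * u" using uu by (simp add: s_def mult.assoc mult.commute[of "cnj u"])
    also have "s = of_real (Re s) + \<i> * of_real (Im s)" by (rule complex_eq)
    finally show ?thesis by (simp add: algebra_simps)
  qed
  define a where "a = \<i> * of_real (Im s / 2) * u"
  have "a - u * u * cnj a = \<i> * of_real (Im s / 2) * u * (1 + u * cnj u)"
    by (simp add: a_def algebra_simps)
  also have "\<dots> = \<i> * of_real (Im s) * u" by (simp add: uu)
  finally have "\<i> * of_real (Im s) * u = a - u * u * cnj a" ..
  then have "g = (\<lambda>z. a + cis (2 * (Arg \<alpha> / 2)) * cnj (z - a) + of_real (Re s) * cis (Arg \<alpha> / 2))"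
    unfolding cis2 u_def[symmetric] using \<beta> by (auto simp: assms(2) \<alpha> algebra_simps)
  then show ?thesis unfolding glide_reflection_def by blast
qed

text \<open>The third assumption says that the determinant of the linear part, p q without a swap
  and - p q with one, is -1.\<close>

lemma glide_reflection_gmap:
  assumes "sign p" "sign q" "sw \<longleftrightarrow> p = q"
  shows "glide_reflection (gmap sw p q a b)"
proof -
  consider "sw" "p = 1" "q = 1" | "sw" "p = -1" "q = -1"
    | "\<not> sw" "p = 1" "q = -1" | "\<not> sw" "p = -1" "q = 1"
    using assms by (auto simp: sign_def)
  then show ?thesis
  proof cases
    case 1
    show ?thesis by (rule glide_reflectionI[of \<i> _ "Complex a b"])
        (auto simp: gmap_def 1 complex_eq_iff)
  next
    case 2
    show ?thesis by (rule glide_reflectionI[of "-\<i>" _ "Complex a b"])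
        (auto simp: gmap_def 2 complex_eq_iff)
  next
    case 3
    show ?thesis by (rule glide_reflectionI[of 1 _ "Complex a b"])
        (auto simp: gmap_def 3 complex_eq_iff)
  next
    case 4
    show ?thesis by (rule glide_reflectionI[of "-1" _ "Complex a b"])
        (auto simp: gmap_def 4 complex_eq_iff)
  qed
qed

text \<open>Every level lattice lies in the Gaussian ideal generated by \<open>v\<close>, so a
  congruence that holds on the level-1 lattice passes to all levels.\<close>

lemma level_vec_gaussian_multiple:
  obtains x y :: int where "level_vec k v = Complex (of_int x) (of_int y) * v"
proof -
  have "level_vec k v = Complex (of_int 1) (of_int 0) * v \<or>
    level_vec k v = Complex (of_int 1) (of_int 1) * v \<or>
    level_vec k v = Complex (of_int 2) (of_int 0) * v \<or>
    level_vec k v = Complex (of_int 2) (of_int 2) * v"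
    by (auto simp: level_vec_def complex_eq_iff algebra_simps)
  then show ?thesis using that by blast
qed

lemma based_on_area_5_imp_trans_cong:
  assumes "based_on_area D 5"
  obtains r where "r = 2 \<or> r = 3"
    "\<And>s t e. design_sym D False 1 1 s t e \<Longrightarrow> (5::int) dvd t - r * s"
proof -
  obtain k v1 c ec ez where lu: "lattice_unit D k v1 c ec ez" and v5: "(cmod v1)\<^sup>2 = 5"
    using assms by (auto simp: based_on_area_def)
  have T: "trans_lattice D = lattice_gen (level_vec k v1)"
    using lu by (simp add: lattice_unit_def)
  obtain M N :: int where v1: "v1 = Complex (of_int M) (of_int N)"
    using lu by (auto simp: lattice_unit_def level1_vec_def)
  have "real_of_int (M\<^sup>2 + N\<^sup>2) = 5" using v5 by (simp add: v1 cmod_def)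
  then have MN: "M\<^sup>2 + N\<^sup>2 = 5" by linarith
  have "M\<^sup>2 < 9" "N\<^sup>2 < 9"
    using MN zero_le_power2[of M] zero_le_power2[of N] by linarith+
  then have "\<bar>M\<bar> < 3" "\<bar>N\<bar> < 3"
    using power2_less_imp_less[of "\<bar>M\<bar>" 3] power2_less_imp_less[of "\<bar>N\<bar>" 3] by simp_all
  then have "M \<in> {-2,-1,0,1,2}" "N \<in> {-2,-1,0,1,2}" by auto
  with MN have "5 dvd N - 2 * M \<and> 5 dvd M + 2 * N \<or> 5 dvd N - 3 * M \<and> 5 dvd M + 3 * N"
    by (elim insertE emptyE) simp_all
  \<comment> \<open>The two divisibilities place both generators, \<open>v1\<close> and i times
    \<open>v1\<close>, in the set t = r s (mod 5).\<close>
  then obtain r where r: "r = 2 \<or> r = 3" "5 dvd N - r * M" "5 dvd M + r * N" by blast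
  have "5 dvd t - r * s" if sym: "design_sym D False 1 1 s t e" for s t e
  proof -
    obtain x y where xy: "level_vec k v1 = Complex (of_int x) (of_int y) * v1"
      by (rule level_vec_gaussian_multiple)
    have "Complex (of_int s) (of_int t) \<in> lattice_gen (level_vec k v1)"
      using sym T trans_lattice_iff by blast
    then obtain a b :: int where "Complex (of_int s) (of_int t)
        = of_int a * level_vec k v1 + of_int b * (\<i> * level_vec k v1)"
      by (auto simp: lattice_gen_def)
    then have "real_of_int s = of_int ((a * x - b * y) * M - (a * y + b * x) * N)"
      "real_of_int t = of_int ((a * x - b * y) * N + (a * y + b * x) * M)"
      unfolding xy by (simp_all add: v1 complex_eq_iff algebra_simps)
    then have st: "s = (a * x - b * y) * M - (a * y + b * x) * N"
      "t = (a * x - b * y) * N + (a * y + b * x) * M"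
      using of_int_eq_iff by blast+
    have "t - r * s = (a * x - b * y) * (N - r * M) + (a * y + b * x) * (M + r * N)"
      unfolding st by (simp add: algebra_simps)
    then show ?thesis using r by simp
  qed
  with r(1) show ?thesis by (rule that)
qed

section \<open>Perfection, striping and redundant cells of the satin colouring\<close>

definition redundant :: "int \<Rightarrow> int \<Rightarrow> int \<Rightarrow> int \<Rightarrow> bool" where
  "redundant r c i j \<longleftrightarrow> j mod 5 = (r * i + c) mod 5"

fun satin_colouring :: "int \<Rightarrow> int \<Rightarrow> strand \<Rightarrow> nat" where
  "satin_colouring r c (Warp i) = nat ((r * i + c) mod 5)"
| "satin_colouring r c (Weft j) = nat (j mod 5)"

lemma satin_colouring_eq_iff:
  "satin_colouring r c (Warp i) = satin_colouring r c (Weft j) \<longleftrightarrow> redundant r c i j"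
  "satin_colouring r c (Weft j) = satin_colouring r c (Warp i) \<longleftrightarrow> redundant r c i j"
  by (auto simp: redundant_def)

text \<open>\<open>5 - r\<close> inverts r modulo 5, since r (5 - r) = 6 for both values of
  r.\<close>

lemma ex_redundant_warp:
  assumes "r = 2 \<or> r = 3"
  shows "redundant r c ((5 - r) * (j - c)) j"
proof -
  have "5 dvd 5 * (c - j)" by simp
  also have "5 * (c - j) = j - (r * ((5 - r) * (j - c)) + c)"
    using assms by (elim disjE) simp_all
  finally show ?thesis
    unfolding redundant_def mod_eq_dvd_iff .
qed

text \<open>The condition on \<open>sw\<close>, \<open>p\<close>, \<open>q\<close> makes the linear
  part a power of i. Following the symmetry by the complementary power of the quarter turn yields a
  translation, to which \<open>T\<close> applies; this is the fact \<open>X\<close> of each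
  case.\<close>

lemma redundant_preserved:
  assumes r: "r = 2 \<or> r = 3" and c: "5 dvd (r - 1) * c - (r * a - b)"
    and T: "\<And>s t e. design_sym D False 1 1 s t e \<Longrightarrow> 5 dvd t - r * s"
    and Q: "design_sym D True (-1) 1 a b e"
    and g: "design_sym D sw p q a' b' e'" "sign p" "sign q" "sw \<longleftrightarrow> p \<noteq> q"
    and red: "redundant r c i j"
  shows "redundant r c (act_x sw p a' i j) (act_y sw q b' i j)"
proof -
  note Q2 = design_sym_compose[OF Q Q]
  note Q3 = design_sym_compose[OF Q2 Q]
  note H = design_sym_compose[OF g(1) Q] design_sym_compose[OF g(1) Q2] design_sym_compose[OF g(1) Q3]
  \<comment> \<open>In each case the goal is an explicit combination of the hypotheses, because
    \<open>r\<^sup>2 = 5 * (r - 1) - 1\<close> for both values of \<open>r\<close>.\<close>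
  have j: "5 dvd j - (r * i + c)"
    using red by (simp add: redundant_def mod_eq_dvd_iff)
  consider "\<not> sw" "p = 1" "q = 1" | "\<not> sw" "p = -1" "q = -1"
    | "sw" "p = -1" "q = 1" | "sw" "p = 1" "q = -1"
    using g(2-4) by (auto simp: sign_def)
  then show ?thesis
    unfolding redundant_def mod_eq_dvd_iff
  proof cases
    case 1
    then have X: "5 dvd b' - r * a'" using T g(1) by simp
    have "act_y sw q b' i j - (r * act_x sw p a' i j + c)
        = (j - (r * i + c)) + (b' - r * a')"
      using r by (elim disjE) (simp_all add: 1 act_x_def act_y_def algebra_simps)
    also have "5 dvd \<dots>"
      by (intro dvd_triv_left dvd_add dvd_diff dvd_mult X j c)
    finally show "5 dvd act_y sw q b' i j - (r * act_x sw p a' i j + c)" .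
  next
    case 2
    then have X: "5 dvd (a + b - b') - r * (a - b - a')" using T H by simp
    have "act_y sw q b' i j - (r * act_x sw p a' i j + c)
        = (r + 1) * ((r - 1) * c - (r * a - b)) - (j - (r * i + c)) - ((a + b - b') - r * (a - b - a')) - 5 * ((r - 1) * (c - a))"
      using r by (elim disjE) (simp_all add: 2 act_x_def act_y_def algebra_simps)
    also have "5 dvd \<dots>"
      by (intro dvd_triv_left dvd_add dvd_diff dvd_mult X j c)
    finally show "5 dvd act_y sw q b' i j - (r * act_x sw p a' i j + c)" .
  next
    case 3
    then have X: "5 dvd (a - a') - r * (b' - b)" using T H by simp
    have "act_y sw q b' i j - (r * act_x sw p a' i j + c)
        = r * (j - (r * i + c)) + r * ((a - a') - r * (b' - b)) + ((r - 1) * c - (r * a - b)) + 5 * ((r - 1) * (i + b' - b))"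
      using r by (elim disjE) (simp_all add: 3 act_x_def act_y_def algebra_simps)
    also have "5 dvd \<dots>"
      by (intro dvd_triv_left dvd_add dvd_diff dvd_mult X j c)
    finally show "5 dvd act_y sw q b' i j - (r * act_x sw p a' i j + c)" .
  next
    case 4
    then have X: "5 dvd (a' + b) - r * (a - b')" using T H by simp
    have "act_y sw q b' i j - (r * act_x sw p a' i j + c)
        = r * ((r - 1) * c - (r * a - b)) - r * (j - (r * i + c)) - r * ((a' + b) - r * (a - b')) + 5 * ((r - 1) * (b' - i - c))"
      using r by (elim disjE) (simp_all add: 4 act_x_def act_y_def algebra_simps)
    also have "5 dvd \<dots>"
      by (intro dvd_triv_left dvd_add dvd_diff dvd_mult X j c)
    finally show "5 dvd act_y sw q b' i j - (r * act_x sw p a' i j + c)" .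
  qed
qed

lemma perfect_satin_colouring:
  assumes r: "r = 2 \<or> r = 3" and c: "5 dvd (r - 1) * c - (r * a - b)"
    and T: "\<And>s t e. design_sym D False 1 1 s t e \<Longrightarrow> 5 dvd t - r * s"
    and Q: "design_sym D True (-1) 1 a b e"
    and no_glide: "\<not> (\<exists>g e. is_sym D g e \<and> glide_reflection g)"
  shows "perfect_colouring D (satin_colouring r c)"
  unfolding perfect_colouring_def
proof (intro allI impI, elim conjE)
  fix g e' s s' t t'
  assume g: "is_sym D g e'" and st: "g ` strand_set s = strand_set t"
    "g ` strand_set s' = strand_set t'" and col: "satin_colouring r c s = satin_colouring r c s'"
  obtain sw p q a' b' where *: "sign p" "sign q" "g = gmap sw p q a' b'"
    "design_sym D sw p q a' b' e'" using g by (rule is_symE)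
  have sw: "sw \<longleftrightarrow> p \<noteq> q" using glide_reflection_gmap[OF *(1,2)] no_glide g *(3) by blast
  have pres: "redundant r c (act_x sw p a' i j) (act_y sw q b' i j)" if "redundant r c i j" for i j
    by (rule redundant_preserved[OF r c _ Q *(4,1,2) sw that]) (rule T)
  let ?A = "act_strand sw p q a' b'" and ?col = "satin_colouring r c"
  have t: "t = ?A s" "t' = ?A s'"
    using st inj_strand_set unfolding *(3) gmap_image_strand[OF *(1,2)] by (auto dest: injD)
  \<comment> \<open>A warp and a weft have equal colours iff their cell is redundant; parallel
    strands are compared below through a strand that crosses both.\<close>
  have cross: "?col (?A (Warp i)) = ?col (?A (Weft j))" if "redundant r c i j" for i j
    using pres[OF that]
    by (cases sw) (simp_all add: act_x_def act_y_def satin_colouring_eq_iff del: satin_colouring.simps)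
  have "?col (?A s) = ?col (?A s')"
  proof (cases s; cases s')
    fix i i' assume s: "s = Warp i" "s' = Warp i'"
    have "redundant r c i (r * i + c)" "redundant r c i' (r * i + c)"
      using col s by (auto simp: redundant_def)
    then show ?thesis using cross s by simp
  next
    fix j j' assume s: "s = Weft j" "s' = Weft j'"
    let ?i = "(5 - r) * (j - c)"
    have "redundant r c ?i j" by (rule ex_redundant_warp[OF r])
    moreover from this have "redundant r c ?i j'" using col s by (auto simp: redundant_def)
    ultimately show ?thesis using cross s by metis
  next
    fix i j assume s: "s = Warp i" "s' = Weft j"
    then show ?thesis using cross col satin_colouring_eq_iff by metis
  next
    fix i j assume s: "s = Weft j" "s' = Warp i"
    then show ?thesis using cross col satin_colouring_eq_iff by metis
  qed
  then show "?col t = ?col t'" by (simp add: t)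
qed

text \<open>Injectivity on the warps holds because r is a unit modulo 5. Five distinct values below
  5 exhaust all colours, so both directions use the same ones.\<close>

lemma thin_striping_satin_colouring:
  assumes "r = 2 \<or> r = 3"
  shows "thin_striping 5 (satin_colouring r c)"
proof -
  define a where "a x = nat ((r * x + c) mod 5)" for x
  define b where "b x = nat (x mod 5)" for x
  have inj: "inj_on a {0..<int 5}"
  proof (rule inj_onI)
    fix x y assume xy: "x \<in> {0..<int 5}" "y \<in> {0..<int 5}" "a x = a y"
    then have "(r * x + c) mod 5 = (r * y + c) mod 5" by (simp add: a_def)
    then have "5 dvd r * x - r * y" by (simp add: mod_eq_dvd_iff)
    then have "5 dvd x - y" using assms by (elim disjE) (simp_all, presburger+)
    then show "x = y" using xy(1,2) by simp presburger
  qed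
  have injb: "inj_on b {0..<int 5}" by (auto simp: inj_on_def b_def)
  have sub: "a ` {0..<int 5} \<subseteq> {..<5}" by (auto simp: a_def nat_less_iff)
  have eq: "a ` {0..<int 5} = {..<5}" using sub inj by (intro card_subset_eq) (simp_all add: card_image)
  have sub': "b ` {0..<int 5} \<subseteq> {..<5}" by (auto simp: b_def nat_less_iff)
  have eq': "b ` {0..<int 5} = {..<5}" using sub' injb by (intro card_subset_eq) (simp_all add: card_image)
  have "satin_colouring r c (Warp i) = a (i mod int 5)" for i
    unfolding a_def by (simp, metis mod_add_left_eq mod_mult_right_eq)
  moreover have "satin_colouring r c (Weft j) = b (j mod int 5)" for j
    by (simp add: b_def)
  ultimately show ?thesis
    unfolding thin_striping_def using inj injb eq eq' by (intro exI[of _ a] exI[of _ b]) simp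
qed

lemma congruent_satin_colouring:
  assumes "r = 2 \<or> r = 3"
  shows "congruent_cells (redundant_cells (satin_colouring r c)) satin_5_3"
proof -
  \<comment> \<open>The satin has slope 2; slope 3 = -2 (mod 5) is its mirror image in a vertical
    axis.\<close>
  define p :: int where "p = (if r = 2 then 1 else -1)"
  have p: "sign p" "sign 1" by (simp_all add: p_def sign_def)
  let ?f = "\<lambda>(i, j). (p * i, j - c)"
  have "gmap False p 1 0 (- c) ` cell_centre ` redundant_cells (satin_colouring r c)
      = cell_centre ` ?f ` redundant_cells (satin_colouring r c)"
    by (auto simp: image_image gmap_def cell_centre_def split_beta)
  also have "?f ` redundant_cells (satin_colouring r c) = satin_5_3"
  proof -
    have mem: "(i, j) \<in> redundant_cells (satin_colouring r c) \<longleftrightarrow> (p * i, j - c) \<in> satin_5_3" for i j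
    proof -
      have "j - c - 2 * (p * i) = (j - (r * i + c)) + 5 * (if r = 2 then 0 else i)"
        using assms by (auto simp: p_def)
      then have "5 dvd j - c - 2 * (p * i) \<longleftrightarrow> 5 dvd j - (r * i + c)"
        by (simp only: dvd_add_left_iff dvd_triv_left)
      then show ?thesis
        by (simp only: redundant_cells_def satin_5_3_def mem_Collect_eq case_prod_conv
          satin_colouring_eq_iff redundant_def mod_eq_dvd_iff)
    qed
    show ?thesis
    proof
      show "?f ` redundant_cells (satin_colouring r c) \<subseteq> satin_5_3"
        by (rule image_subsetI) (simp only: mem split_paired_all case_prod_conv)
      show "satin_5_3 \<subseteq> ?f ` redundant_cells (satin_colouring r c)"
      proof
        fix z assume z: "z \<in> satin_5_3"
        have pp: "p * (p * fst z) = fst z" using p by (auto simp: sign_def)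
        have "(p * fst z, snd z + c) \<in> redundant_cells (satin_colouring r c)"
          unfolding mem pp using z by simp
        moreover have "z = ?f (p * fst z, snd z + c)" by (simp only: case_prod_conv pp) simp
        ultimately show "z \<in> ?f ` redundant_cells (satin_colouring r c)" by (rule rev_image_eqI)
      qed
    qed
  qed
  finally show ?thesis
    unfolding congruent_cells_def using plane_isometry_gmap[OF p] by blast
qed

lemma area_5_satin_colourable:
  assumes "p4_isonemal D" "based_on_area D 5"
  shows "\<exists>col :: strand \<Rightarrow> nat. thin_striping 5 col \<and> perfect_colouring D col \<and>
    congruent_cells (redundant_cells col) satin_5_3"
proof -
  obtain z e where "qcentre D z e" and no_glide: "\<not> (\<exists>g e. is_sym D g e \<and> glide_reflection g)"
    using assms(1) by (auto simp: p4_isonemal_def)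
  then obtain a b where Q: "design_sym D True (-1) 1 a b e" by (auto elim: qcentreE)
  obtain r where r: "r = 2 \<or> r = 3"
    and T: "\<And>s t e. design_sym D False 1 1 s t e \<Longrightarrow> 5 dvd t - r * s"
    using based_on_area_5_imp_trans_cong[OF assms(2)] by blast
  \<comment> \<open>\<open>7 - 3 * r\<close> inverts r - 1 modulo 5: it is 1 for r = 2 and -2 for r
    = 3.\<close>
  define c where "c = (7 - 3 * r) * (r * a - b)"
  have "(r - 1) * c - (r * a - b) = 0 \<or> (r - 1) * c - (r * a - b) = - 5 * (3 * a - b)"
    using r by (auto simp: c_def)
  then have "5 dvd (r - 1) * c - (r * a - b)" by (metis dvd_0_right dvd_minus_iff dvd_triv_left mult_minus_left)
  then have "perfect_colouring D (satin_colouring r c)"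
    by (rule perfect_satin_colouring[OF r _ _ Q no_glide]) (rule T)
  with thin_striping_satin_colouring[OF r] congruent_satin_colouring[OF r]
  show ?thesis by blast
qed

subsection \<open>Symmetry groups of designs\<close>

text \<open>A layer contains every strand that passes over one of its members. By
  \<open>step\<close> some warp passes over weft j and under weft j + 1, so a layer climbs by one
  weft at a time; periodicity also lets it jump down, hence it contains all wefts.\<close>

lemma not_falls_apart:
  fixes n :: int
  assumes n: "n > 0" and per: "\<And>i j. D i (j + n) = D i j"
    and step: "\<And>j. \<exists>i. D i j \<and> \<not> D i (j + 1)"
    and dark: "\<And>i. \<exists>j. D i j" and pale: "\<And>i. \<exists>j. \<not> D i j"
  shows "\<not> falls_apart D"
proof
  assume "falls_apart D"
  then obtain L where L: "L \<noteq> {}" "L \<noteq> UNIV"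
    and warp: "\<And>i j. Warp i \<in> L \<Longrightarrow> \<not> D i j \<Longrightarrow> Weft j \<in> L"
    and weft: "\<And>i j. Weft j \<in> L \<Longrightarrow> D i j \<Longrightarrow> Warp i \<in> L"
    unfolding falls_apart_def by blast
  have per': "D i (j - int k * n) = D i j" for i j k
  proof (induction k)
    case (Suc k)
    have "D i (j - int (Suc k) * n) = D i (j - int (Suc k) * n + n)" by (rule per[symmetric])
    also have "j - int (Suc k) * n + n = j - int k * n" by (simp add: algebra_simps)
    finally show ?case using Suc by simp
  qed simp
  have forward: "Weft (j + 1 - int k * n) \<in> L" if "Weft j \<in> L" for j k
  proof -
    obtain i where "D i j" "\<not> D i (j + 1)" using step by blast
    then show ?thesis using warp weft that per' by blast
  qed
  have up: "Weft (j + int k) \<in> L" if "Weft j \<in> L" for j k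
  proof (induction k)
    case (Suc k)
    then show ?case using forward[of "j + int k" 0] by (simp add: algebra_simps)
  qed (use that in simp)
  have all: "Weft j' \<in> L" if "Weft j \<in> L" for j j'
  proof -
    \<comment> \<open>Going down \<open>k\<close> periods of length at least 1 ends at or below
      \<open>j'\<close>, wherever \<open>j'\<close> lies, and the rest is climbing.\<close>
    define k where "k = nat (\<bar>j\<bar> + \<bar>j'\<bar> + 1)"
    have "int k * 1 \<le> int k * n" using n by (intro mult_left_mono) simp_all
    moreover have "int k = \<bar>j\<bar> + \<bar>j'\<bar> + 1" by (simp add: k_def)
    ultimately have "j + 1 - int k * n \<le> j'" by linarith
    then have "j' = j + 1 - int k * n + int (nat (j' - (j + 1 - int k * n)))" by simp
    then show ?thesis using up[OF forward[OF that]] by metis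
  qed
  have "\<exists>j. Weft j \<in> L"
  proof -
    obtain s where "s \<in> L" using L by blast
    then show ?thesis using warp pale by (cases s) blast+
  qed
  then have wefts: "Weft j \<in> L" for j using all by blast
  then have "Warp i \<in> L" for i using weft dark by blast
  then have "s \<in> L" for s using wefts by (cases s) auto
  then show False using L by blast
qed

text \<open>Transitivity on strands in terms of integer parameters, free of isometries and point
  sets.\<close>

definition reach :: "(int \<Rightarrow> int \<Rightarrow> bool) \<Rightarrow> strand \<Rightarrow> strand \<Rightarrow> bool" where
  "reach D s t \<longleftrightarrow> (\<exists>sw p q a b e. sign p \<and> sign q \<and> design_sym D sw p q a b e \<and>
     act_strand sw p q a b s = t)"

lemma reach_trans:
  assumes "reach D s t" "reach D t u"
  shows "reach D s u"
proof -
  obtain sw p q a b e where 1: "sign p" "sign q" "design_sym D sw p q a b e"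
    "act_strand sw p q a b s = t" using assms(1) by (auto simp: reach_def)
  obtain sw' p' q' a' b' e' where 2: "sign p'" "sign q'" "design_sym D sw' p' q' a' b' e'"
    "act_strand sw' p' q' a' b' t = u" using assms(2) by (auto simp: reach_def)
  have "sign (p' * (if sw' then q else p))" "sign (q' * (if sw' then p else q))"
    using 1 2 by (auto simp: sign_def)
  moreover have "act_strand (sw \<noteq> sw') (p' * (if sw' then q else p)) (q' * (if sw' then p else q))
    (p' * (if sw' then b else a) + a') (q' * (if sw' then a else b) + b') s = u"
    unfolding 1(4)[symmetric] 2(4)[symmetric] by (cases s) (auto simp: algebra_simps)
  ultimately show ?thesis
    using design_sym_compose[OF 1(3) 2(3)] unfolding reach_def by blast
qed

lemma isonemal_iff_reach: "isonemal D \<longleftrightarrow> (\<forall>s t. reach D s t)"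
proof -
  have "(\<exists>g e. is_sym D g e \<and> g ` strand_set s = strand_set t) \<longleftrightarrow> reach D s t" for s t
  proof
    assume "\<exists>g e. is_sym D g e \<and> g ` strand_set s = strand_set t"
    then obtain g e where g: "is_sym D g e" "g ` strand_set s = strand_set t" by blast
    from g(1) obtain sw p q a b where *: "sign p" "sign q" "g = gmap sw p q a b"
      "design_sym D sw p q a b e" by (rule is_symE)
    have "strand_set (act_strand sw p q a b s) = strand_set t"
      using g(2) gmap_image_strand[OF *(1,2)] *(3) by simp
    then have "act_strand sw p q a b s = t" by (rule injD[OF inj_strand_set])
    then show "reach D s t" using * unfolding reach_def by blast
  next
    assume "reach D s t"
    then obtain sw p q a b e where "sign p" "sign q" "design_sym D sw p q a b e"
      "act_strand sw p q a b s = t" by (auto simp: reach_def)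
    then show "\<exists>g e. is_sym D g e \<and> g ` strand_set s = strand_set t"
      using is_sym_gmap_iff gmap_image_strand by metis
  qed
  then show ?thesis unfolding isonemal_def by simp
qed

section \<open>Translation vectors of a design\<close>

definition trans_vec :: "(int \<Rightarrow> int \<Rightarrow> bool) \<Rightarrow> int \<Rightarrow> int \<Rightarrow> bool" where
  "trans_vec D a b \<longleftrightarrow> (\<exists>e. design_sym D False 1 1 a b e)"

lemma trans_vec_add:
  assumes "trans_vec D a b" "trans_vec D a' b'"
  shows "trans_vec D (a + a') (b + b')"
  using assms design_sym_compose[of D False 1 1 a b _ False 1 1 a' b']
  unfolding trans_vec_def by fastforce

lemma trans_vec_minus:
  assumes "trans_vec D a b"
  shows "trans_vec D (- a) (- b)"
proof -
  obtain e where e: "\<And>i j. D (i + a) (j + b) = (D i j \<noteq> e)"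
    using assms by (auto simp: trans_vec_def design_sym_def act_x_def act_y_def)
  have "D (i - a) (j - b) = (D i j \<noteq> e)" for i j using e[of "i - a" "j - b"] by auto
  then have "design_sym D False 1 1 (- a) (- b) e"
    by (simp add: design_sym_def act_x_def act_y_def)
  then show ?thesis by (auto simp: trans_vec_def)
qed

lemma trans_vec_mult:
  assumes "trans_vec D a b"
  shows "trans_vec D (m * a) (m * b)"
proof (induction m rule: int_induct[where k = 0])
  case base
  have "design_sym D False 1 1 0 0 False" by (simp add: design_sym_def act_x_def act_y_def)
  then show ?case by (auto simp: trans_vec_def)
next
  case (step1 m)
  then show ?case using trans_vec_add[OF step1(2) assms] by (simp add: algebra_simps)
next
  case (step2 m)
  then show ?case using trans_vec_add[OF step2(2) trans_vec_minus[OF assms]]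
    by (simp add: algebra_simps)
qed

text \<open>Conjugating a translation by a symmetry gives the translation along the image of its
  vector under the linear part. This makes the lattice invariant under any glide-reflection that
  might exist.\<close>

lemma trans_vec_conjugate:
  assumes "sign p" "sign q" "design_sym D sw p q c d e" "trans_vec D a b"
  shows "trans_vec D (p * (if sw then b else a)) (q * (if sw then a else b))"
proof -
  obtain f where f: "\<And>i j. D (i + a) (j + b) = (D i j \<noteq> f)"
    using assms(4) by (auto simp: trans_vec_def design_sym_def act_x_def act_y_def)
  have g: "D (act_x sw p c i j) (act_y sw q d i j) = (D i j \<noteq> (sw \<noteq> e))" for i j
    using assms(3) by (simp add: design_sym_def)
  have "D (x + p * (if sw then b else a)) (y + q * (if sw then a else b)) = (D x y \<noteq> f)" for x y
  proof -
    define i where "i = (if sw then q * (y - d) else p * (x - c))"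
    define j where "j = (if sw then p * (x - c) else q * (y - d))"
    have xy: "act_x sw p c i j = x" "act_y sw q d i j = y"
      using assms(1,2) by (auto simp: i_def j_def act_x_def act_y_def sign_def)
    have "act_x sw p c (i + a) (j + b) = act_x sw p c i j + p * (if sw then b else a)"
      "act_y sw q d (i + a) (j + b) = act_y sw q d i j + q * (if sw then a else b)"
      by (simp_all add: act_x_def act_y_def algebra_simps)
    then show ?thesis using g[of "i + a" "j + b"] g[of i j] f[of i j] xy by auto
  qed
  then have "design_sym D False 1 1 (p * (if sw then b else a)) (q * (if sw then a else b)) f"
    by (simp add: design_sym_def act_x_def act_y_def)
  then show ?thesis by (auto simp: trans_vec_def)
qed

subsection \<open>Examples given by residues\<close>

definition residue_dark :: "int list list \<Rightarrow> int \<Rightarrow> int \<Rightarrow> bool" where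
  "residue_dark K u w \<longleftrightarrow> u mod 20 \<in> set (K ! nat (w mod 4))"

text \<open>The lattice generated by 4(1 + 2i) is the kernel of the map from the cells (i, j) to the
  pairs (j + 3i mod 20, i mod 4).  It consists of side-preserving translations in all the
  examples below, so that the examples can be tabulated in terms of these residues.\<close>
definition weave :: "int list list \<Rightarrow> int \<Rightarrow> int \<Rightarrow> bool" where
  "weave K i j = residue_dark K (j + 3 * i) i"

text \<open>As \<open>w\<close> matters only modulo 4, its coefficient in the first component must
  satisfy 4 n = 0 (mod 20) for an affine map to act on residue pairs. Translations have n = 0,
  quarter turns n = 10.\<close>

lemma residue_dark_mod:
  "residue_dark K (m * (u mod 20) + n * (w mod 4) + a) (m' * (u mod 20) + n' * (w mod 4) + b)
     = residue_dark K (m * u + n * w + a) (m' * u + n' * w + b)" if "20 dvd 4 * n"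
proof -
  have "5 dvd n" using that by presburger
  then obtain l where l: "n = 5 * l" by (elim dvdE)
  define x where "x = u div 20"
  define y where "y = w div 4"
  have u: "u = u mod 20 + 20 * x" and w: "w = w mod 4 + 4 * y"
    by (simp_all add: x_def y_def)
  have "m * u + n * w + a = m * (u mod 20) + n * (w mod 4) + a + 20 * (m * x + l * y)"
    by (subst u, subst w) (simp add: l algebra_simps)
  moreover have "m' * u + n' * w + b = m' * (u mod 20) + n' * (w mod 4) + b + 4 * (5 * m' * x + n' * y)"
    by (subst u, subst w) (simp add: algebra_simps)
  ultimately show ?thesis unfolding residue_dark_def by (metis mod_mult_self2)
qed

definition all_residues :: "(int \<Rightarrow> int \<Rightarrow> bool) \<Rightarrow> bool" where
  "all_residues R \<longleftrightarrow> (\<forall>u\<in>set [0..19]. \<forall>w\<in>set [0..3]. R u w)"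

lemma all_residuesD:
  assumes "all_residues R"
  shows "R (u mod 20) (w mod 4)"
proof -
  have "u mod 20 \<le> 19" "w mod 4 \<le> 3"
    using pos_mod_bound[of 20 u] pos_mod_bound[of 4 w] by linarith+
  then show ?thesis
    using assms unfolding all_residues_def set_upto by simp
qed

definition translation_law :: "int list list \<Rightarrow> int \<Rightarrow> int \<Rightarrow> bool \<Rightarrow> bool" where
  "translation_law K d s e \<longleftrightarrow>
     all_residues (\<lambda>u w. residue_dark K (u + d) (w + s) = (residue_dark K u w \<noteq> e))"

text \<open>With u = j + 3i and w = i, the turn to (a - j, i + b) makes the new i equal to 3w - u +
  a, and the new j + 3i equal to 10w - 3u + b + 3a.\<close>

definition quarter_turn_law :: "int list list \<Rightarrow> int \<Rightarrow> int \<Rightarrow> bool \<Rightarrow> bool" where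
  "quarter_turn_law K a b e \<longleftrightarrow> all_residues (\<lambda>u w.
     residue_dark K (10 * w - 3 * u + b + 3 * a) (3 * w - u + a) = (residue_dark K u w = e))"

lemma residue_dark_mod_mod: "residue_dark K (u mod 20) (w mod 4) = residue_dark K u w"
  by (simp add: residue_dark_def)

lemma design_sym_weave_translation_iff:
  "design_sym (weave K) False 1 1 a b e \<longleftrightarrow> translation_law K ((b + 3 * a) mod 20) (a mod 4) e"
proof -
  have rd: "residue_dark K (u + (b + 3 * a) mod 20) (w + a mod 4)
      = residue_dark K (u + (b + 3 * a)) (w + a)" for u w
    by (simp add: residue_dark_def mod_simps)
  show ?thesis
  proof
    assume sym: "design_sym (weave K) False 1 1 a b e"
    have "residue_dark K (u + (b + 3 * a)) (w + a) = (residue_dark K u w \<noteq> e)" for u w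
    proof -
      have "weave K (w + a) (u - 3 * w + b) = (weave K w (u - 3 * w) \<noteq> e)"
        using sym by (simp add: design_sym_def act_x_def act_y_def)
      then show ?thesis by (simp add: weave_def algebra_simps)
    qed
    then show "translation_law K ((b + 3 * a) mod 20) (a mod 4) e"
      by (simp add: translation_law_def rd all_residues_def)
  next
    assume law: "translation_law K ((b + 3 * a) mod 20) (a mod 4) e"
    have *: "residue_dark K (u + (b + 3 * a)) (w + a) = (residue_dark K u w \<noteq> e)" for u w
      using all_residuesD[OF law[unfolded translation_law_def rd], where u = u and w = w]
        residue_dark_mod[of 0 K 1 u w "b + 3 * a" 0 1 a] residue_dark_mod_mod[of K u w]
      by (simp add: residue_dark_def mod_simps)
    have "weave K (i + a) (j + b) = (weave K i j \<noteq> e)" for i j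
      using *[of "j + 3 * i" i] by (simp add: weave_def algebra_simps)
    then show "design_sym (weave K) False 1 1 a b e"
      by (simp add: design_sym_def act_x_def act_y_def)
  qed
qed

lemma design_sym_weave_quarter_turn:
  assumes "quarter_turn_law K a b e"
  shows "design_sym (weave K) True (-1) 1 a b e"
proof -
  have *: "residue_dark K (10 * w - 3 * u + b + 3 * a) (3 * w - u + a) = (residue_dark K u w = e)" for u w
    using all_residuesD[OF assms[unfolded quarter_turn_law_def], where u = u and w = w]
      residue_dark_mod[of 10 K "-3" u w "b + 3 * a" "-1" 3 a] residue_dark_mod_mod[of K u w]
    by (simp add: algebra_simps)
  have "weave K (- j + a) (i + b) = (weave K i j = e)" for i j
    using *[of i "j + 3 * i"] by (simp add: weave_def algebra_simps)
  then show ?thesis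
    by (auto simp add: design_sym_def act_x_def act_y_def)
qed

text \<open>The coordinates of the level vector over 1 + 2i.\<close>
definition side :: "nat \<Rightarrow> int \<times> int" where
  "side k = (if k = 1 then (1, 2) else if k = 2 then (-1, 3) else if k = 3 then (2, 4) else (-2, 6))"

text \<open>The lattice of level k consists of the (a, b) with b + 3a and a divisible by these moduli.\<close>
definition side_moduli :: "nat \<Rightarrow> int \<times> int" where
  "side_moduli k = (if k = 1 then (5, 1) else if k = 2 then (10, 1) else if k = 3 then (10, 2) else (20, 2))"

lemma level_vec_side:
  assumes "k \<in> {1, 2, 3, 4}"
  shows "level_vec k (Complex 1 2) = Complex (of_int (fst (side k))) (of_int (snd (side k)))"
  using assms by (auto simp: level_vec_def side_def complex_eq_iff)

lemma lattice_gen_int: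
  "z \<in> lattice_gen (Complex (of_int x) (of_int y)) \<longleftrightarrow>
    (\<exists>a b. z = Complex (of_int (a * x - b * y)) (of_int (a * y + b * x)))"
  unfolding lattice_gen_def by (simp add: complex_eq_iff)

text \<open>The witnesses invert a linear system: for k = 1 it is x - 2y = n, x - y = m, once the
  factor 5 is cancelled. Levels 3 and 4 are levels 1 and 2 with all coordinates doubled, so they
  reuse the same witnesses.\<close>

lemma side_lattice:
  assumes k: "k \<in> {1, 2, 3, 4}" and "fst (side_moduli k) dvd b + 3 * a" "snd (side_moduli k) dvd a"
  obtains x y where "a = x * fst (side k) - y * snd (side k)" "b = x * snd (side k) + y * fst (side k)"
proof -
  obtain m where "b + 3 * a = fst (side_moduli k) * m"
    using assms(2) by (elim dvdE)
  then have m: "b = fst (side_moduli k) * m - 3 * a" by simp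
  obtain n where n: "a = snd (side_moduli k) * n"
    using assms(3) by (elim dvdE)
  from k consider "k = 1" | "k = 2" | "k = 3" | "k = 4" by auto
  then show ?thesis
  proof cases
    case 1
    show ?thesis by (rule that[of "2 * m - n" "m - n"]) (simp_all add: m n 1 side_def side_moduli_def)
  next
    case 2
    show ?thesis by (rule that[of "3 * m - n" "- m"]) (simp_all add: m n 2 side_def side_moduli_def)
  next
    case 3
    show ?thesis by (rule that[of "2 * m - n" "m - n"]) (simp_all add: m n 3 side_def side_moduli_def)
  next
    case 4
    show ?thesis by (rule that[of "3 * m - n" "- m"]) (simp_all add: m n 4 side_def side_moduli_def)
  qed
qed

text \<open>The turn about (a/2, a/2) has parameters (a, 0). The centre of the unit is half a
  diagonal away, which adds the side (x, y) to the parameters. The two turns therefore differ by the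
  translation along that side, which is side-preserving iff their types agree; hence
  \<open>ec \<noteq> ez\<close>. The last two conjuncts serve to show that the design does not fall
  apart.\<close>

definition certificate :: "int list list \<Rightarrow> nat \<Rightarrow> int \<Rightarrow> bool \<Rightarrow> bool \<Rightarrow> bool" where
  "certificate K k a ec ez \<longleftrightarrow>
    (let (x, y) = side k; (m, n) = side_moduli k in
      k \<in> {1, 2, 3, 4} \<and> (k \<in> {1, 2} \<or> a = 1) \<and>
      quarter_turn_law K a 0 ec \<and> quarter_turn_law K (a + x) y ez \<and>
      translation_law K ((y + 3 * x) mod 20) (x mod 4) (ec \<noteq> ez) \<and>
      translation_law K ((x - 3 * y) mod 20) (- y mod 4) (ec \<noteq> ez) \<and>
      all_residues (\<lambda>d s. d mod m = 0 \<and> s mod n = 0 \<or>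
        \<not> translation_law K d s False \<and> \<not> translation_law K d s True) \<and>
      (\<forall>j\<in>set [0..19]. \<exists>i\<in>set [0..19]. weave K i j \<and> \<not> weave K i (j + 1)) \<and>
      (\<forall>i\<in>set [0..19]. (\<exists>j\<in>set [0..19]. weave K i j) \<and> (\<exists>j\<in>set [0..19]. \<not> weave K i j)))"

section \<open>Designs that satisfy a certificate\<close>

locale certified_weave =
  fixes K :: "int list list" and k :: nat and a :: int and ec ez :: bool
    and x y m n :: int
  assumes cert: "certificate K k a ec ez"
    and side: "side k = (x, y)" and moduli: "side_moduli k = (m, n)"
begin

lemma level: "k \<in> {1, 2, 3, 4}"
  and quarter_turn_a: "quarter_turn_law K a 0 ec"
  and quarter_turn_ax: "quarter_turn_law K (a + x) y ez"
  and translation: "translation_law K ((y + 3 * x) mod 20) (x mod 4) (ec \<noteq> ez)"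
    "translation_law K ((x - 3 * y) mod 20) (- y mod 4) (ec \<noteq> ez)"
  and no_translation: "all_residues (\<lambda>d s. d mod m = 0 \<and> s mod n = 0 \<or>
        \<not> translation_law K d s False \<and> \<not> translation_law K d s True)"
  and incomparable: "\<forall>j\<in>{0..19}. \<exists>i\<in>{0..19}. weave K i j \<and> \<not> weave K i (j + 1)"
  and dark_pale: "\<forall>i\<in>{0..19}. (\<exists>j\<in>{0..19}. weave K i j) \<and> (\<exists>j\<in>{0..19}. \<not> weave K i j)"
  and corner: "k \<in> {1, 2} \<or> a = 1"
  using cert[unfolded certificate_def side moduli Let_def case_prod_conv set_upto]
  by - (elim conjE, assumption)+

lemma moduli_dvd: "m dvd 20" "n dvd 4"
  using moduli by (auto simp: side_moduli_def split: if_splits)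

lemma trans_vec_side: "trans_vec (weave K) x y" "trans_vec (weave K) (- y) x"
  using translation unfolding trans_vec_def design_sym_weave_translation_iff by auto

lemma trans_vec_lattice: "trans_vec (weave K) (s * x - t * y) (s * y + t * x)"
  using trans_vec_add[OF trans_vec_mult[OF trans_vec_side(1), of s]
    trans_vec_mult[OF trans_vec_side(2), of t]] by simp

lemma trans_vec_iff:
  "trans_vec (weave K) s t \<longleftrightarrow> (\<exists>p q. s = p * x - q * y \<and> t = p * y + q * x)"
proof
  assume "trans_vec (weave K) s t"
  then obtain e where "translation_law K ((t + 3 * s) mod 20) (s mod 4) e"
    by (auto simp: trans_vec_def design_sym_weave_translation_iff)
  then have "(t + 3 * s) mod 20 mod m = 0 \<and> s mod 4 mod n = 0"
    using all_residuesD[OF no_translation, of "t + 3 * s" s] by (cases e) auto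
  then have "m dvd t + 3 * s" "n dvd s"
    by (simp_all only: moduli_dvd[THEN mod_mod_cancel] dvd_eq_mod_eq_0)
  then obtain p q where "s = p * x - q * y" "t = p * y + q * x"
    by (rule side_lattice[OF level, of t s, unfolded side moduli fst_conv snd_conv])
  then show "\<exists>p q. s = p * x - q * y \<and> t = p * y + q * x" by blast
qed (use trans_vec_lattice in blast)

lemma trans_lattice_weave: "trans_lattice (weave K) = lattice_gen (level_vec k (Complex 1 2))"
proof -
  have "z \<in> trans_lattice (weave K) \<longleftrightarrow> z \<in> lattice_gen (Complex (of_int x) (of_int y))" for z
    unfolding lattice_gen_int trans_lattice_iff using trans_vec_iff unfolding trans_vec_def by metis
  then show ?thesis using level_vec_side[OF level] side by auto
qed

lemma no_glide_reflection:
  assumes "is_sym (weave K) g e"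
  shows "\<not> glide_reflection g"
proof
  assume glide: "glide_reflection g"
  from assms obtain sw p q c d where *: "sign p" "sign q" "g = gmap sw p q c d"
    "design_sym (weave K) sw p q c d e" by (rule is_symE)
  have five: "5 dvd t - 2 * s" if "trans_vec (weave K) s t" for s t
  proof -
    obtain u v where st: "s = u * x - v * y" "t = u * y + v * x"
      using \<open>trans_vec (weave K) s t\<close> unfolding trans_vec_iff by blast
    have "5 dvd y - 2 * x" "5 dvd x + 2 * y"
      using side by (auto simp: side_def split: if_splits)
    moreover have "t - 2 * s = u * (y - 2 * x) + v * (x + 2 * y)"
      unfolding st by (simp add: algebra_simps)
    ultimately show ?thesis by simp
  qed
  have "sw \<longleftrightarrow> p = q"
  proof (rule ccontr)
    assume "\<not> (sw \<longleftrightarrow> p = q)"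
    obtain c' th s where g: "g = (\<lambda>z. c' + cis (2 * th) * cnj (z - c') + of_real s * cis th)"
      using glide unfolding glide_reflection_def by blast
    \<comment> \<open>The factor -i records that orientation is reversed; a direct isometry would
      have i instead.\<close>
    have "g 1 - g 0 = cis (2 * th)" "g \<i> - g 0 = - \<i> * cis (2 * th)"
      by (simp_all add: g algebra_simps)
    then have "g \<i> - g 0 = - \<i> * (g 1 - g 0)" by simp
    then show False using *(1-3) \<open>\<not> (sw \<longleftrightarrow> p = q)\<close>
      by (auto simp: gmap_def sign_def complex_eq_iff split: if_splits)
  qed
  \<comment> \<open>Up to sign the side (x, y) goes to (x, -y) or (y, x), which would again be a
    translation vector.\<close>
  then have "5 dvd y + 2 * x \<or> 5 dvd x - 2 * y"
    using five[OF trans_vec_conjugate[OF *(1,2,4) trans_vec_side(1)]] *(1,2)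
    by (auto simp: sign_def dvd_diff_commute split: if_splits) presburger+
  then show False using side by (auto simp: side_def split: if_splits)
qed

lemma qcentre_a: "qcentre (weave K) (Complex (of_int a / 2) (of_int a / 2)) ec"
  using is_sym_gmap_iff[of "-1" 1 "weave K" True a 0 ec] design_sym_weave_quarter_turn[OF quarter_turn_a]
  by (simp add: qcentre_def gmap_quarter_turn sign_def)

lemma qcentre_ax: "qcentre (weave K)
    (unit_centre (Complex (of_int a / 2) (of_int a / 2)) (level_vec k (Complex 1 2))) ez"
proof -
  have "unit_centre (Complex (of_int a / 2) (of_int a / 2)) (level_vec k (Complex 1 2))
      = Complex ((of_int (a + x) - of_int y) / 2) ((of_int (a + x) + of_int y) / 2)"
    unfolding level_vec_side[OF level] side
    by (simp add: unit_centre_def complex_eq_iff add_divide_distrib diff_divide_distrib)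
  then show ?thesis
    using is_sym_gmap_iff[of "-1" 1 "weave K" True "a + x" y ez]
      design_sym_weave_quarter_turn[OF quarter_turn_ax]
    by (simp only: qcentre_def gmap_quarter_turn) (simp add: sign_def)
qed

lemma lattice_unit_weave:
  "lattice_unit (weave K) k (Complex 1 2) (Complex (of_int a / 2) (of_int a / 2)) ec ez"
proof -
  have "level1_vec (Complex 1 2)"
    unfolding level1_vec_def by (intro exI[of _ 1] exI[of _ 2]) simp
  then show ?thesis
    unfolding lattice_unit_def using level trans_lattice_weave qcentre_a qcentre_ax by simp
qed

lemma weave_mod: "weave K (i mod 20) j = weave K i j" "weave K i (j mod 20) = weave K i j"
proof -
  have "(j + 3 * (i mod 20)) mod 20 = (j + 3 * i) mod 20"
    by (metis mod_add_right_eq mod_mult_right_eq)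
  moreover have "i mod 20 mod 4 = i mod 4" by (simp add: mod_mod_cancel)
  ultimately show "weave K (i mod 20) j = weave K i j"
    by (simp only: weave_def residue_dark_def)
  show "weave K i (j mod 20) = weave K i j"
    by (simp only: weave_def residue_dark_def mod_add_left_eq)
qed

lemma periodic: "weave K (i + 20) j = weave K i j" "weave K i (j + 20) = weave K i j"
  by (metis mod_add_self2 weave_mod)+

lemma fabric_weave: "fabric (weave K)"
proof -
  have "prefabric (weave K)"
    unfolding prefabric_def using periodic
    by (intro exI[of _ 20] exI[of _ 0] exI[of _ 0] exI[of _ 20]) simp
  moreover have "\<not> falls_apart (weave K)"
  proof (rule not_falls_apart[of 20])
    have in20: "i mod 20 \<in> {0..19}" for i :: int
      using pos_mod_bound[of 20 i] by simp
    show "\<exists>i. weave K i j \<and> \<not> weave K i (j + 1)" for j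
    proof -
      obtain i where "weave K i (j mod 20)" "\<not> weave K i (j mod 20 + 1)"
        using incomparable in20 by blast
      then have "weave K i j" "\<not> weave K i (j + 1)"
        using weave_mod(2)[of i j] weave_mod(2)[of i "j mod 20 + 1"] weave_mod(2)[of i "j + 1"]
        by (auto simp: mod_simps)
      then show ?thesis by blast
    qed
    show "\<exists>j. weave K i j" "\<exists>j. \<not> weave K i j" for i
      using dark_pale in20 weave_mod(1)[of i] by metis+
  qed (simp_all add: periodic)
  ultimately show ?thesis by (simp add: fabric_def)
qed

lemma isonemal_weave: "isonemal (weave K)"
proof -
  let ?R = "reach (weave K)"
  have turn: "design_sym (weave K) True (-1) 1 a 0 ec"
    by (rule design_sym_weave_quarter_turn[OF quarter_turn_a])
  have to_weft: "?R (Warp i) (Weft i)" for i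
    unfolding reach_def
    by (rule exI[of _ True], rule exI[of _ "-1"], rule exI[of _ 1], rule exI[of _ a], rule exI[of _ 0])
      (use turn in \<open>auto simp: sign_def\<close>)
  have to_warp: "?R (Weft j) (Warp (a - j))" for j
    unfolding reach_def
    by (rule exI[of _ True], rule exI[of _ "-1"], rule exI[of _ 1], rule exI[of _ a], rule exI[of _ 0])
      (use turn in \<open>auto simp: sign_def\<close>)
  have shift: "?R (Warp i) (Warp (i + s * x))" for i s
  proof -
    obtain e where "design_sym (weave K) False 1 1 (s * x) (s * y) e"
      using trans_vec_mult[OF trans_vec_side(1)] unfolding trans_vec_def by blast
    then show ?thesis
      unfolding reach_def
      by (intro exI[of _ False] exI[of _ 1] exI[of _ "s * x"] exI[of _ "s * y"] exI[of _ e])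
        (simp add: sign_def)
  qed
  have shift_dvd: "?R (Warp i) (Warp i')" if "x dvd i' - i" for i i'
  proof -
    from that obtain s where "i' - i = x * s" by (elim dvdE)
    then have "i' = i + s * x" by (simp add: algebra_simps)
    then show ?thesis using shift by simp
  qed
  have half: "?R (Warp i) (Warp (a - i))" for i
    by (rule reach_trans[OF to_weft to_warp])
  have warps: "?R (Warp i) (Warp i')" for i i'
  proof (cases "x dvd i' - i")
    case False
    \<comment> \<open>At levels 1 and 2, \<open>x\<close> is 1 or -1 and divides everything.
      Otherwise it is 2 or -2, and the half turn i to 1 - i joins the two parity classes of
      warps.\<close>
    then have x: "x dvd 2" "a = 1" and odd: "odd (i' - i)"
      using corner side level by (auto simp: side_def split: if_splits)
    have "even (i' - (a - i))" using odd x by simp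
    then have "x dvd i' - (a - i)" using x dvd_trans by blast
    then show ?thesis using reach_trans[OF half shift_dvd] by blast
  qed (rule shift_dvd)
  have "?R s t" for s t
  proof -
    have "\<exists>i. ?R s (Warp i)" using warps to_warp by (cases s) blast+
    moreover have "?R (Warp i) t" for i
      using warps reach_trans[OF warps to_weft] by (cases t) blast+
    ultimately show ?thesis using reach_trans by blast
  qed
  then show ?thesis by (simp add: isonemal_iff_reach)
qed

lemma p4_isonemal_weave: "p4_isonemal (weave K)"
  unfolding p4_isonemal_def
  using fabric_weave isonemal_weave qcentre_a no_glide_reflection by blast

end

lemma certificate_sound:
  assumes "certificate K k a ec ez"
  shows "p4_isonemal (weave K)"
    and "lattice_unit (weave K) k (Complex 1 2) (Complex (of_int a / 2) (of_int a / 2)) ec ez"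
proof -
  interpret certified_weave K k a ec ez "fst (side k)" "snd (side k)"
    "fst (side_moduli k)" "snd (side_moduli k)"
    by unfold_locales (simp_all add: assms)
  show "p4_isonemal (weave K)"
    "lattice_unit (weave K) k (Complex 1 2) (Complex (of_int a / 2) (of_int a / 2)) ec ez"
    by (rule p4_isonemal_weave lattice_unit_weave)+
qed

section \<open>One design for each subspecies\<close>

fun level_of :: "subspecies \<Rightarrow> nat" where
  "level_of S39 = 1" | "level_of S36_1 = 1"
| "level_of S36_2 = 2" | "level_of S36_s = 2" | "level_of S34 = 2"
| "level_of S38 = 3" | "level_of S33_3 = 3" | "level_of S35_3 = 3"
| "level_of S33_4 = 4" | "level_of S35_4 = 4" | "level_of S37 = 4"

text \<open>The corner of the unit is put at (0, 0), a cell centre, or at (1/2, 1/2), a cell corner.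
  A quarter turn about a cell centre exchanges the two strands of that cell, so it is never
  side-preserving: white corners require the value 1. For \<open>S39\<close> the black centres sit
  at the corners of the unit, and the white one falls on a cell corner.\<close>

definition corner_of :: "subspecies \<Rightarrow> int" where
  "corner_of S = (if S \<in> {S36_1, S36_s, S39} then 0 else 1)"

definition black_corner :: "subspecies \<Rightarrow> bool" where
  "black_corner S \<longleftrightarrow> S \<notin> {S33_3, S33_4, S34, S37, S38}"

definition black_centre :: "subspecies \<Rightarrow> bool" where
  "black_centre S \<longleftrightarrow> S \<notin> {S33_3, S33_4, S34, S39}"

text \<open>Found by computer search: unions of cell orbits under the prescribed group that admit no
  further translations.\<close>
fun example :: "subspecies \<Rightarrow> int list list" where
  "example S33_3 = concat (replicate 2
     [[1, 4, 7, 8, 9, 11, 14, 17, 18, 19], [0, 3, 5, 6, 7, 10, 13, 15, 16, 17]])"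
| "example S33_4 = concat (replicate 2
     [[1, 7, 8, 11, 13, 14, 16, 17, 18, 19], [3, 5, 6, 7, 8, 10, 11, 13, 16, 17]])"
| "example S34 = replicate 4 [1, 3, 6, 7, 8, 11, 13, 16, 17, 18]"
| "example S35_3 = concat (replicate 2 [[6, 9, 16, 19], [5, 8, 15, 18]])"
| "example S35_4 = concat (replicate 2 [[15, 18], [6, 9]])"
| "example S36_1 = replicate 4 [0, 5, 10, 15]"
| "example S36_2 = replicate 4 [5, 6, 8, 9, 15, 16, 18, 19]"
| "example S36_s = replicate 4 [5, 15]"
| "example S37 =
     [[1, 8, 10, 11, 13, 16, 17], [3, 7, 8, 11, 13, 14, 16],
      [0, 2, 3, 4, 5, 6, 7, 9, 12, 14, 15, 18, 19], [0, 1, 2, 4, 5, 6, 9, 10, 12, 15, 17, 18, 19]]"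
| "example S38 = concat (replicate 2
     [[1, 7, 8, 10, 12, 13, 14, 15, 16, 19], [3, 5, 8, 9, 10, 11, 12, 14, 16, 17]])"
| "example S39 = replicate 4 [2, 4, 5, 6, 8, 12, 14, 15, 16, 18]"

definition certified :: "subspecies \<Rightarrow> bool" where
  "certified S \<longleftrightarrow> certificate (example S) (level_of S) (corner_of S) (black_corner S) (black_centre S)"

text \<open>Each claim is a closed computation on residues. A list repeated four times gives a
  design that depends on j + 3i alone: \<open>S36_1\<close> is the satin j = 2i (mod 5) itself, and
  \<open>S36_s\<close> has the dark cells j + 3i = 5 (mod 10).\<close>

lemma certified_examples:
  "certified S33_3" "certified S33_4" "certified S34" "certified S35_3" "certified S35_4"
  "certified S36_1" "certified S36_2" "certified S36_s" "certified S37" "certified S38" "certified S39"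
  by code_simp+

lemma example_in_subspecies:
  "in_subspecies S (weave (example S))" "based_on_area (weave (example S)) 5"
proof -
  let ?c = "Complex (of_int (corner_of S) / 2) (of_int (corner_of S) / 2)"
  have "certified S" using certified_examples by (cases S) simp_all
  note sound = certificate_sound[OF this[unfolded certified_def]]
  have "subsp_cond S (level_of S) ?c (black_corner S) (black_centre S)"
    by (cases S) (simp_all add: corner_of_def black_corner_def black_centre_def
      at_cell_corner_def at_cell_centre_def)
  then show "in_subspecies S (weave (example S))"
    unfolding in_subspecies_def using sound by blast
  have "(cmod (Complex 1 2))\<^sup>2 = 5" by (simp add: cmod_def)
  then show "based_on_area (weave (example S)) 5"
    unfolding based_on_area_def using sound(2) by blast
qed

theorem theorem1:
  fixes S :: subspecies
  shows "\<exists>n::nat.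
    (\<exists>D. in_subspecies S D \<and> based_on_area D 5 \<and> order D = n) \<and>
    (\<forall>D. in_subspecies S D \<and> based_on_area D 5 \<and> order D = n \<longrightarrow>
       (\<exists>col :: strand \<Rightarrow> nat. thin_striping 5 col \<and> perfect_colouring D col \<and>
          congruent_cells (redundant_cells col) satin_5_3))"
proof (rule exI[of _ "order (weave (example S))"], intro conjI allI impI)
  show "\<exists>D. in_subspecies S D \<and> based_on_area D 5 \<and> order D = order (weave (example S))"
    using example_in_subspecies by blast
  fix D assume "in_subspecies S D \<and> based_on_area D 5 \<and> order D = order (weave (example S))"
  then have "p4_isonemal D" "based_on_area D 5" by (simp_all add: in_subspecies_def)
  then show "\<exists>col :: strand \<Rightarrow> nat. thin_striping 5 col \<and> perfect_colouring D col \<and>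
      congruent_cells (redundant_cells col) satin_5_3"
    by (rule area_5_satin_colourable)
qed

end
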